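(* Let $\tau$ be a type assignment, and let $I$ be a valid base type interpretation such that every function symbol $\mathsf f\in\mathcal F$ is computable. If $C;\Gamma\vdash_\tau t:T$ and $(\mu,\sigma)\models C;\Gamma$, then $t\sigma\in[\![T]\!]^I_\mu$.
   Context: Terms. Fix disjoint sets $\mathcal X$ of term variables, $\mathcal C$ of constructor symbols (containing $\mathsf{true}$, $\mathsf{false}$) and $\mathcal F$ of function symbols. Terms: $t::=x\mid \mathsf c\mid\mathsf f\mid\lambda x.t\mid t\,t\mid (t,t)\mid\mathsf{fst}\,t\mid\mathsf{snd}\,t\mid \mathsf{let}\ x=t\ \mathsf{in}\ t\mid\mathsf{if}\ t\ \mathsf{then}\ t\ \mathsf{else}\ t$, up to renaming of bound variables. Patterns: $p::=x\mid\mathsf c\,p_1\dots p_n$. Sizes and constraints. Size sorts $nat$, $bool$; $\mathcal A$ is a sorted first-order term algebra of size expressions over size variables, containing at least $0,1:nat$, $+,\max:nat\times nat\to nat$, $\mathtt{tt},\mathtt{ff}:bool$. Each sort $s$ has a well-founded interpretation domain $(\mathcal D_s,>_s)$, $\mathcal D_{bool}=\{\mathbf{tt},\mathbf{ff}\}$. Write $\mathbf{tt}^*=\mathsf{true}$, $\mathbf{ff}^*=\mathsf{false}$. Valuations $\mu$ map size variables to domain elements; $a\mu$ is the value of $a$; $\mu+^{\vec\alpha}_{\vec\kappa}$ is $\mu$ updated by $\vec\alpha\mapsto\vec\kappa$. A constraint is a first-order formula over $\mathcal A$; $\mathbb C$ is a fixed class of constraints containing $\top$; $\mu\models C$ means $\mu$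 satisfies $C$; $\vdash C$ means every $\mu$ with $FV(C)\subseteq\mathrm{dom}(\mu)$ satisfies $C$. Types. Fix a set $\mathcal B$ of type names containing $\mathsf{Bool}$; $\kappa_{\mathsf{Bool}}=bool$, $\kappa_{\mathsf B}=nat$ otherwise. Types: $T::=\mathsf B^a\mid T\to T\mid T\times T\mid\forall\vec\alpha P.T\mid\exists\vec\alpha P.T$ ($a$ of sort $\kappa_{\mathsf B}$, $P\in\mathbb C$). Basic types: $B::=\mathsf B^a\mid B\times B$; $\exists$-basic types: $E::=B\mid\exists\vec\alpha P.E$ with $\vdash\exists\vec\alpha P$. Subtyping: $C\vdash T\le U$ iff $\vdash C\Rightarrow[\![T\le U]\!]$ where $[\![\mathsf B^a\le\mathsf B^b]\!]=(a=b)$; $[\![T\to U\le T'\to U']\!]=[\![T'\le T]\!]\wedge[\![U\le U']\!]$; $[\![T\times U\le T'\times U']\!]=[\![T\le T']\!]\wedge[\![U\le U']\!]$; $[\![T\le\exists\vec\alpha P.U]\!]=\exists\vec\alpha(P\wedge[\![T\le U]\!])$ ($\vec\alpha\notin T$, $T$ not an $\exists$-type); $[\![\exists\vec\alpha P.U\le T]\!]=\forall\vec\alpha(P\Rightarrow[\![U\le T]\!])$ ($\vec\alpha\notin T$); $[\![T\le\forall\vec\alpha P.U]\!]=\forall\vec\alpha(P\Rightarrow[\![T\le U]\!])$ ($\vec\alpha\notin T$); $[\![\forall\vec\alpha P.U\le T]\!]=\exists\vec\alpha(P\wedge[\![U\le T]\!])$ ($\vec\alpha\notin T$, $T$ not a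 $\forall$-type). Typing. Environments $\Gamma$: finite maps from term variables to types. A type assignment $\tau$ maps each symbol of $\mathcal C\cup\mathcal F$ to a closed type, with $\tau_{\mathsf{true}}=\mathsf{Bool}^{\mathtt{tt}}$, $\tau_{\mathsf{false}}=\mathsf{Bool}^{\mathtt{ff}}$. $C;\Gamma\vdash_\tau t:T$ is defined by the rules: (var) $x:x\Gamma$ for $x\in\mathrm{dom}(\Gamma)$; (symb) $\mathsf s:\tau_{\mathsf s}$; (abs) from $C;\Gamma,x:T\vdash u:U$, $x\notin\mathrm{dom}\Gamma$, infer $\lambda x.u:T\to U$; (app) from $t:U\to V$, $u:U$ infer $t\,u:V$; (pair) from $u:U$, $v:V$ infer $(u,v):U\times V$; (fst), (snd) from $t:U\times V$ infer $\mathsf{fst}\,t:U$, $\mathsf{snd}\,t:V$; (if) from $t:\exists\alpha.\mathsf{Bool}^\alpha$, $u:T$, $v:T$ with $T$ $\exists$-basic infer $\mathsf{if}\ t\ \mathsf{then}\ u\ \mathsf{else}\ v:T$; (let) from $C;\Gamma\vdash t:T$, $C;\Gamma,x:T\vdash u:U$, $x\notin\mathrm{dom}\Gamma$ infer $\mathsf{let}\ x=t\ \mathsf{in}\ u:U$; ($\forall$intro) from $C\wedge P;\Gamma\vdash t:T$, $\vdash C\Rightarrow\exists\vec\alpha P$, $\vec\alpha$ not in $C,\Gamma$ infer $C;\Gamma\vdash t:\forall\vec\alpha P.T$; ($\forall$elim) from $t:\forall\vec\alpha P.T$, $\vdash C\Rightarrow P[\vec\alpha:=\vec a]$ infer $t:T[\vec\alpha:=\vec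 a]$; ($\exists$intro) from $t:T[\vec\alpha:=\vec a]$, $\vdash C\Rightarrow P[\vec\alpha:=\vec a]$ infer $t:\exists\vec\alpha P.T$; ($\exists$elim) from $C;\Gamma\vdash t:\exists\vec\alpha P.T$, $C\wedge P;\Gamma,x:T\vdash u:U$, $\vdash C\Rightarrow\exists\vec\alpha P$, $\vec\alpha,x$ not in $C,\Gamma,U$ infer $C;\Gamma\vdash\mathsf{let}\ x=t\ \mathsf{in}\ u:U$; (sub) from $t:T$, $C\vdash T\le T'$ infer $t:T'$ (all premises and conclusions under the same $C;\Gamma$ unless indicated). Rewriting. Head-$\beta$: $(\lambda x.u)t\to u[x:=t]$, $\mathsf{let}\ x=t\ \mathsf{in}\ u\to u[x:=t]$, $\mathsf{fst}(u,v)\to u$, $\mathsf{snd}(u,v)\to v$, $\mathsf{if}\ \mathsf{true}\ \mathsf{then}\ u\ \mathsf{else}\ v\to u$, $\mathsf{if}\ \mathsf{false}\ \mathsf{then}\ u\ \mathsf{else}\ v\to v$; this is $\to_{\beta h}$, and $\to_\beta$ is its closure under contexts. A set $\mathcal R$ of conditional rules $\vec t=\vec{\mathsf c}\Rightarrow l\to r$ is given, with $l=\mathsf f\,\vec l$, $\vec l$ patterns, $\vec{\mathsf c}\in\{\mathsf{true},\mathsf{false}\}$, $FV(r,\vec t)\subseteq FV(l)$. $\to_{\mathcal R}$ is the smallest relation closed under contexts and substitutions with $l\sigma\to_{\mathcal R}r\sigma$ whenever $t_i\sigma\to^* \mathsf c_i$ for all $i$, where $\to\,=\,\to_\beta\cup\to_{\mathcal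 R}$. Standing assumption: $\to$ is locally confluent. $\mathrm{SN}$ is the set of strongly normalizing terms and $\mathrm{nf}(t)$ the (unique) normal form of $t\in\mathrm{SN}$. Saturated sets. Elimination contexts: $E::=[\,]\mid E\,t\mid\mathsf{fst}\,E\mid\mathsf{snd}\,E$. $\mathrm{SAT}$ is the set of sets $S$ of terms such that: (1) $S\subseteq\mathrm{SN}$; (2) $S$ is closed under $\to$; (3) $E[x]\in S$ whenever $x$ is a variable and $E[x]\in\mathrm{SN}$; (4) if $t\in\mathrm{SN}$, $t\to_{\beta h}t'$ and $E[t']\in S$, then $E[t]\in S$. $S_1\to S_2=\{t\mid\forall u\in S_1,\ t\,u\in S_2\}$, $S_1\times S_2=\{t\mid\mathsf{fst}\,t\in S_1,\ \mathsf{snd}\,t\in S_2\}$. Neutral terms: terms of the form $\mathsf f\,\vec t$ ($\mathsf f\in\mathcal F$), $\mathsf{if}\ t\ \mathsf{then}\ u\ \mathsf{else}\ v$, $\mathsf{fst}\,t$, $\mathsf{snd}\,t$. $S$ has the neutral term property if every neutral $s$ all of whose one-step $\to$-reducts lie in $S$ belongs to $S$. Interpretation. A base type interpretation $I$ assigns to each $\mathsf B\ne\mathsf{Bool}$ and $\kappa\in\mathcal D_{nat}$ a set $I^\kappa_{\mathsf B}\in\mathrm{SAT}$; it is extended by $I^\kappa_{\mathsf{Bool}}=\{t\in\mathrm{SN}\mid\mathrm{nf}(t)\ne\overline\kappa^*\}$ where $\overline\kappa$ is the element of $\mathcal D_{bool}$ different from $\kappa$. Then $[\![\mathsf B^a]\!]^I_\mu=I^{a\mu}_{\mathsf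 B}$, $[\![U\times V]\!]^I_\mu=[\![U]\!]^I_\mu\times[\![V]\!]^I_\mu$, $[\![U\to V]\!]^I_\mu=[\![U]\!]^I_\mu\to[\![V]\!]^I_\mu$, $[\![\forall\vec\alpha P.T]\!]^I_\mu=\bigcap_{\mu+^{\vec\alpha}_{\vec\kappa}\models P}[\![T]\!]^I_{\mu+^{\vec\alpha}_{\vec\kappa}}$ if $\vdash\exists\vec\alpha P$ and $\mathrm{SN}$ otherwise, $[\![\exists\vec\alpha P.T]\!]^I_\mu=\bigcup_{\mu+^{\vec\alpha}_{\vec\kappa}\models P}[\![T]\!]^I_{\mu+^{\vec\alpha}_{\vec\kappa}}$ if $\vdash\exists\vec\alpha P$ and $\bigcap\mathrm{SAT}$ otherwise. A symbol $\mathsf s$ is computable if $\mathsf s\in[\![\tau_{\mathsf s}]\!]^I$. $(\mu,\sigma)\models C;\Gamma$ ($\sigma$ a term substitution) means $\mu\models C$ and $x\sigma\in[\![x\Gamma]\!]^I_\mu$ for all $x\in\mathrm{dom}(\Gamma)$. $I$ is valid if every constructor is computable and, for every $\exists$-basic type $T$ and valuation $\mu$, $[\![T]\!]^I_\mu$ has the neutral term property.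
   Formalization: In the interpretation of ∀α⃗P.T and ∃α⃗P.T the condition ⊢∃α⃗P is replaced by μ⊨∃α⃗P, because with the former the claim fails (e.g. P = C = (n=0) and ∃intro); the two readings agree whenever ⊢∃α⃗P holds or P is unsatisfiable. *)

theory Defs
  imports Main
begin

section \<open>Size expressions and constraints\<close>

text \<open>
  Size variables are de Bruijn indices, one index space for each of the sorts \<open>nat\<close> and
  \<open>bool\<close>; hence expressions, valuations and substitutions respect sorts by construction.
  \<open>NFun\<close> and \<open>BFun\<close> stand for the further function symbols of the algebra; a symbol is
  identified by its name, its result sort and the numbers of its arguments of either sort.
\<close>

datatype 'g nexp =
    NVar nat | SZero | SOne | SPlus "'g nexp" "'g nexp" | SMax "'g nexp" "'g nexp"
  | NFun 'g "'g nexp list" "'g bexp list"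
and 'g bexp =
    BVar nat | TT | FF
  | BFun 'g "'g nexp list" "'g bexp list"

text \<open>
  \<open>CAll m n\<close> and \<open>CEx m n\<close> bind a whole vector of variables: the \<open>nat\<close>-variables with
  indices below \<open>m\<close> and the \<open>bool\<close>-variables with indices below \<open>n\<close>.
\<close>

datatype 'g constr =
    CTop | CBot
  | NEq "'g nexp" "'g nexp" | BEq "'g bexp" "'g bexp"
  | NGt "'g nexp" "'g nexp" | BGt "'g bexp" "'g bexp"
  | CNot "'g constr"
  | CAnd "'g constr" "'g constr" | COr "'g constr" "'g constr" | CImp "'g constr" "'g constr"
  | CAll nat nat "'g constr" | CEx nat nat "'g constr"

type_synonym 'g ssub = "(nat \<Rightarrow> 'g nexp) \<times> (nat \<Rightarrow> 'g bexp)"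

primrec nsub :: "'g ssub \<Rightarrow> 'g nexp \<Rightarrow> 'g nexp"
  and bsub :: "'g ssub \<Rightarrow> 'g bexp \<Rightarrow> 'g bexp" where
  "nsub s (NVar i) = fst s i"
| "nsub s SZero = SZero"
| "nsub s SOne = SOne"
| "nsub s (SPlus a b) = SPlus (nsub s a) (nsub s b)"
| "nsub s (SMax a b) = SMax (nsub s a) (nsub s b)"
| "nsub s (NFun g as bs) = NFun g (map (nsub s) as) (map (bsub s) bs)"
| "bsub s (BVar i) = snd s i"
| "bsub s TT = TT"
| "bsub s FF = FF"
| "bsub s (BFun g as bs) = BFun g (map (nsub s) as) (map (bsub s) bs)"

definition shift :: "nat \<Rightarrow> nat \<Rightarrow> 'g ssub" where
  "shift m n = (\<lambda>i. NVar (i + m), \<lambda>i. BVar (i + n))"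

definition up_ssub :: "nat \<Rightarrow> nat \<Rightarrow> 'g ssub \<Rightarrow> 'g ssub" where
  "up_ssub m n s =
     (\<lambda>i. if i < m then NVar i else nsub (shift m n) (fst s (i - m)),
      \<lambda>i. if i < n then BVar i else bsub (shift m n) (snd s (i - n)))"

text \<open>
  \<open>inst_ssub m n s\<close> instantiates the variables of the outermost binder by the first \<open>m\<close>,
  respectively \<open>n\<close>, entries of \<open>s\<close>; the other entries of \<open>s\<close> are irrelevant.
\<close>

definition inst_ssub :: "nat \<Rightarrow> nat \<Rightarrow> 'g ssub \<Rightarrow> 'g ssub" where
  "inst_ssub m n s =
     (\<lambda>i. if i < m then fst s i else NVar (i - m),
      \<lambda>i. if i < n then snd s i else BVar (i - n))"

primrec csub :: "'g ssub \<Rightarrow> 'g constr \<Rightarrow> 'g constr" where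
  "csub s CTop = CTop"
| "csub s CBot = CBot"
| "csub s (NEq a b) = NEq (nsub s a) (nsub s b)"
| "csub s (BEq a b) = BEq (bsub s a) (bsub s b)"
| "csub s (NGt a b) = NGt (nsub s a) (nsub s b)"
| "csub s (BGt a b) = BGt (bsub s a) (bsub s b)"
| "csub s (CNot C) = CNot (csub s C)"
| "csub s (CAnd C D) = CAnd (csub s C) (csub s D)"
| "csub s (COr C D) = COr (csub s C) (csub s D)"
| "csub s (CImp C D) = CImp (csub s C) (csub s D)"
| "csub s (CAll m n C) = CAll m n (csub (up_ssub m n s) C)"
| "csub s (CEx m n C) = CEx m n (csub (up_ssub m n s) C)"

primrec nclosed :: "nat \<Rightarrow> nat \<Rightarrow> 'g nexp \<Rightarrow> bool"
  and bclosed :: "nat \<Rightarrow> nat \<Rightarrow> 'g bexp \<Rightarrow> bool" where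
  "nclosed k l (NVar i) \<longleftrightarrow> i < k"
| "nclosed k l SZero \<longleftrightarrow> True"
| "nclosed k l SOne \<longleftrightarrow> True"
| "nclosed k l (SPlus a b) \<longleftrightarrow> nclosed k l a \<and> nclosed k l b"
| "nclosed k l (SMax a b) \<longleftrightarrow> nclosed k l a \<and> nclosed k l b"
| "nclosed k l (NFun g as bs) \<longleftrightarrow> list_all (nclosed k l) as \<and> list_all (bclosed k l) bs"
| "bclosed k l (BVar i) \<longleftrightarrow> i < l"
| "bclosed k l TT \<longleftrightarrow> True"
| "bclosed k l FF \<longleftrightarrow> True"
| "bclosed k l (BFun g as bs) \<longleftrightarrow> list_all (nclosed k l) as \<and> list_all (bclosed k l) bs"

primrec cclosed :: "nat \<Rightarrow> nat \<Rightarrow> 'g constr \<Rightarrow> bool" where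
  "cclosed k l CTop \<longleftrightarrow> True"
| "cclosed k l CBot \<longleftrightarrow> True"
| "cclosed k l (NEq a b) \<longleftrightarrow> nclosed k l a \<and> nclosed k l b"
| "cclosed k l (BEq a b) \<longleftrightarrow> bclosed k l a \<and> bclosed k l b"
| "cclosed k l (NGt a b) \<longleftrightarrow> nclosed k l a \<and> nclosed k l b"
| "cclosed k l (BGt a b) \<longleftrightarrow> bclosed k l a \<and> bclosed k l b"
| "cclosed k l (CNot C) \<longleftrightarrow> cclosed k l C"
| "cclosed k l (CAnd C D) \<longleftrightarrow> cclosed k l C \<and> cclosed k l D"
| "cclosed k l (COr C D) \<longleftrightarrow> cclosed k l C \<and> cclosed k l D"
| "cclosed k l (CImp C D) \<longleftrightarrow> cclosed k l C \<and> cclosed k l D"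
| "cclosed k l (CAll m n C) \<longleftrightarrow> cclosed (k + m) (l + n) C"
| "cclosed k l (CEx m n C) \<longleftrightarrow> cclosed (k + m) (l + n) C"

text \<open>
  The interpretation domains are the type \<open>'d\<close> for sort \<open>nat\<close> and the type \<^typ>\<open>bool\<close> for
  sort \<open>bool\<close>. \<open>cclass\<close> is the class of constraints that may occur in types.
\<close>

record ('g, 'd) size_alg =
  zeroI :: 'd
  oneI :: 'd
  plusI :: "'d \<Rightarrow> 'd \<Rightarrow> 'd"
  maxI :: "'d \<Rightarrow> 'd \<Rightarrow> 'd"
  nfunI :: "'g \<Rightarrow> 'd list \<Rightarrow> bool list \<Rightarrow> 'd"
  bfunI :: "'g \<Rightarrow> 'd list \<Rightarrow> bool list \<Rightarrow> bool"
  ngt :: "'d \<Rightarrow> 'd \<Rightarrow> bool"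
  bgt :: "bool \<Rightarrow> bool \<Rightarrow> bool"
  cclass :: "'g constr set"

definition size_algebra :: "('g, 'd) size_alg \<Rightarrow> bool" where
  "size_algebra A \<longleftrightarrow>
     wfp (\<lambda>x y. ngt A y x) \<and> wfp (\<lambda>x y. bgt A y x) \<and> CTop \<in> cclass A"

text \<open>
  Valuations are total; as both domains are nonempty, this does not affect the meaning of
  \<open>valid\<close> below.
\<close>

type_synonym 'd valn = "(nat \<Rightarrow> 'd) \<times> (nat \<Rightarrow> bool)"

text \<open>\<open>ext_valn m n \<kappa> \<mu>\<close> depends only on the first \<open>m\<close>, respectively \<open>n\<close>, entries of \<open>\<kappa>\<close>.\<close>

definition ext_valn :: "nat \<Rightarrow> nat \<Rightarrow> 'd valn \<Rightarrow> 'd valn \<Rightarrow> 'd valn" where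
  "ext_valn m n \<kappa> \<mu> =
     (\<lambda>i. if i < m then fst \<kappa> i else fst \<mu> (i - m),
      \<lambda>i. if i < n then snd \<kappa> i else snd \<mu> (i - n))"

primrec neval :: "('g, 'd) size_alg \<Rightarrow> 'd valn \<Rightarrow> 'g nexp \<Rightarrow> 'd"
  and beval :: "('g, 'd) size_alg \<Rightarrow> 'd valn \<Rightarrow> 'g bexp \<Rightarrow> bool" where
  "neval A \<mu> (NVar i) = fst \<mu> i"
| "neval A \<mu> SZero = zeroI A"
| "neval A \<mu> SOne = oneI A"
| "neval A \<mu> (SPlus a b) = plusI A (neval A \<mu> a) (neval A \<mu> b)"
| "neval A \<mu> (SMax a b) = maxI A (neval A \<mu> a) (neval A \<mu> b)"
| "neval A \<mu> (NFun g as bs) = nfunI A g (map (neval A \<mu>) as) (map (beval A \<mu>) bs)"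
| "beval A \<mu> (BVar i) = snd \<mu> i"
| "beval A \<mu> TT = True"
| "beval A \<mu> FF = False"
| "beval A \<mu> (BFun g as bs) = bfunI A g (map (neval A \<mu>) as) (map (beval A \<mu>) bs)"

primrec sat :: "('g, 'd) size_alg \<Rightarrow> 'd valn \<Rightarrow> 'g constr \<Rightarrow> bool" where
  "sat A \<mu> CTop \<longleftrightarrow> True"
| "sat A \<mu> CBot \<longleftrightarrow> False"
| "sat A \<mu> (NEq a b) \<longleftrightarrow> neval A \<mu> a = neval A \<mu> b"
| "sat A \<mu> (BEq a b) \<longleftrightarrow> beval A \<mu> a = beval A \<mu> b"
| "sat A \<mu> (NGt a b) \<longleftrightarrow> ngt A (neval A \<mu> a) (neval A \<mu> b)"
| "sat A \<mu> (BGt a b) \<longleftrightarrow> bgt A (beval A \<mu> a) (beval A \<mu> b)"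
| "sat A \<mu> (CNot C) \<longleftrightarrow> \<not> sat A \<mu> C"
| "sat A \<mu> (CAnd C D) \<longleftrightarrow> sat A \<mu> C \<and> sat A \<mu> D"
| "sat A \<mu> (COr C D) \<longleftrightarrow> sat A \<mu> C \<or> sat A \<mu> D"
| "sat A \<mu> (CImp C D) \<longleftrightarrow> (sat A \<mu> C \<longrightarrow> sat A \<mu> D)"
| "sat A \<mu> (CAll m n C) \<longleftrightarrow> (\<forall>\<kappa>. sat A (ext_valn m n \<kappa> \<mu>) C)"
| "sat A \<mu> (CEx m n C) \<longleftrightarrow> (\<exists>\<kappa>. sat A (ext_valn m n \<kappa> \<mu>) C)"

definition valid :: "('g, 'd) size_alg \<Rightarrow> 'g constr \<Rightarrow> bool" where
  "valid A C \<longleftrightarrow> (\<forall>\<mu>. sat A \<mu> C)"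


section \<open>Types and subtyping\<close>

text \<open>\<open>'b\<close> is the type of the type names other than \<open>Bool\<close>.\<close>

datatype ('b, 'g) ty =
    TBool "'g bexp"
  | TBase 'b "'g nexp"
  | Arr "('b, 'g) ty" "('b, 'g) ty"
  | Prod "('b, 'g) ty" "('b, 'g) ty"
  | TAll nat nat "'g constr" "('b, 'g) ty"
  | TEx nat nat "'g constr" "('b, 'g) ty"

primrec tsub :: "'g ssub \<Rightarrow> ('b, 'g) ty \<Rightarrow> ('b, 'g) ty" where
  "tsub s (TBool a) = TBool (bsub s a)"
| "tsub s (TBase B a) = TBase B (nsub s a)"
| "tsub s (Arr T U) = Arr (tsub s T) (tsub s U)"
| "tsub s (Prod T U) = Prod (tsub s T) (tsub s U)"
| "tsub s (TAll m n P T) = TAll m n (csub (up_ssub m n s) P) (tsub (up_ssub m n s) T)"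
| "tsub s (TEx m n P T) = TEx m n (csub (up_ssub m n s) P) (tsub (up_ssub m n s) T)"

primrec tclosed :: "nat \<Rightarrow> nat \<Rightarrow> ('b, 'g) ty \<Rightarrow> bool" where
  "tclosed k l (TBool a) \<longleftrightarrow> bclosed k l a"
| "tclosed k l (TBase B a) \<longleftrightarrow> nclosed k l a"
| "tclosed k l (Arr T U) \<longleftrightarrow> tclosed k l T \<and> tclosed k l U"
| "tclosed k l (Prod T U) \<longleftrightarrow> tclosed k l T \<and> tclosed k l U"
| "tclosed k l (TAll m n P T) \<longleftrightarrow> cclosed (k + m) (l + n) P \<and> tclosed (k + m) (l + n) T"
| "tclosed k l (TEx m n P T) \<longleftrightarrow> cclosed (k + m) (l + n) P \<and> tclosed (k + m) (l + n) T"

primrec is_type :: "('g, 'd) size_alg \<Rightarrow> ('b, 'g) ty \<Rightarrow> bool" where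
  "is_type A (TBool a) \<longleftrightarrow> True"
| "is_type A (TBase B a) \<longleftrightarrow> True"
| "is_type A (Arr T U) \<longleftrightarrow> is_type A T \<and> is_type A U"
| "is_type A (Prod T U) \<longleftrightarrow> is_type A T \<and> is_type A U"
| "is_type A (TAll m n P T) \<longleftrightarrow> P \<in> cclass A \<and> is_type A T"
| "is_type A (TEx m n P T) \<longleftrightarrow> P \<in> cclass A \<and> is_type A T"

inductive basic :: "('b, 'g) ty \<Rightarrow> bool" where
  "basic (TBool a)"
| "basic (TBase B a)"
| "basic T \<Longrightarrow> basic U \<Longrightarrow> basic (Prod T U)"

inductive ex_basic :: "('g, 'd) size_alg \<Rightarrow> ('b, 'g) ty \<Rightarrow> bool" for A where
  "basic T \<Longrightarrow> ex_basic A T"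
| "ex_basic A T \<Longrightarrow> P \<in> cclass A \<Longrightarrow> valid A (CEx m n P) \<Longrightarrow> ex_basic A (TEx m n P T)"

fun is_All :: "('b, 'g) ty \<Rightarrow> bool" where
  "is_All (TAll m n P T) = True"
| "is_All _ = False"

fun is_Ex :: "('b, 'g) ty \<Rightarrow> bool" where
  "is_Ex (TEx m n P T) = True"
| "is_Ex _ = False"

fun same_head :: "('b, 'g) ty \<Rightarrow> ('b, 'g) ty \<Rightarrow> bool" where
  "same_head (TBool a) (TBool b) = True"
| "same_head (TBase B a) (TBase B' b) = (B = B')"
| "same_head (Arr T U) (Arr T' U') = True"
| "same_head (Prod T U) (Prod T' U') = True"
| "same_head _ _ = False"

text \<open>
  \<open>sub_constr T U D\<close>: the formula \<open>D\<close> is obtained by unfolding the equations that define the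
  constraint \<open>T \<le> U\<close>. This is a relation because the equations for quantified types overlap
  (for instance if \<open>T\<close> is a universal and \<open>U\<close> an existential type), and the resulting
  formulas need not be equivalent; every choice of equations is admitted. Unquantified types
  with distinct head constructors give the unsatisfiable constraint. A type in which the
  variables of a binder do not occur is one that is shifted under this binder.
\<close>

inductive sub_constr :: "('b, 'g) ty \<Rightarrow> ('b, 'g) ty \<Rightarrow> 'g constr \<Rightarrow> bool" where
  bool: "sub_constr (TBool a) (TBool b) (BEq a b)"
| base: "sub_constr (TBase B a) (TBase B b) (NEq a b)"
| arr: "sub_constr T' T C \<Longrightarrow> sub_constr U U' D \<Longrightarrow>
    sub_constr (Arr T U) (Arr T' U') (CAnd C D)"
| prod: "sub_constr T T' C \<Longrightarrow> sub_constr U U' D \<Longrightarrow>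
    sub_constr (Prod T U) (Prod T' U') (CAnd C D)"
| ex_right: "\<not> is_Ex T \<Longrightarrow> sub_constr (tsub (shift m n) T) U C \<Longrightarrow>
    sub_constr T (TEx m n P U) (CEx m n (CAnd P C))"
| ex_left: "sub_constr U (tsub (shift m n) T) C \<Longrightarrow>
    sub_constr (TEx m n P U) T (CAll m n (CImp P C))"
| all_right: "sub_constr (tsub (shift m n) T) U C \<Longrightarrow>
    sub_constr T (TAll m n P U) (CAll m n (CImp P C))"
| all_left: "\<not> is_All T \<Longrightarrow> sub_constr U (tsub (shift m n) T) C \<Longrightarrow>
    sub_constr (TAll m n P U) T (CEx m n (CAnd P C))"
| clash: "\<not> is_All T \<Longrightarrow> \<not> is_Ex T \<Longrightarrow> \<not> is_All U \<Longrightarrow> \<not> is_Ex U \<Longrightarrow> \<not> same_head T U \<Longrightarrow>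
    sub_constr T U CBot"

definition subtype :: "('g, 'd) size_alg \<Rightarrow> 'g constr \<Rightarrow> ('b, 'g) ty \<Rightarrow> ('b, 'g) ty \<Rightarrow> bool" where
  "subtype A C T U \<longleftrightarrow> (\<exists>D. sub_constr T U D \<and> valid A (CImp C D))"


section \<open>Terms\<close>

text \<open>
  Terms up to renaming of bound variables: term variables are de Bruijn indices, \<open>Lam u\<close>
  and \<open>LetIn t u\<close> bind the variable 0 of \<open>u\<close>. Constructor and function symbols are
  separated by the signature below.
\<close>

datatype 's tm =
    Var nat
  | Sym 's
  | Lam "'s tm"
  | App "'s tm" "'s tm"
  | Pr "'s tm" "'s tm"
  | Fst "'s tm"
  | Snd "'s tm"
  | LetIn "'s tm" "'s tm"
  | Ite "'s tm" "'s tm" "'s tm"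

abbreviation apps :: "'s tm \<Rightarrow> 's tm list \<Rightarrow> 's tm" where
  "apps \<equiv> foldl App"

primrec fv :: "'s tm \<Rightarrow> nat set" where
  "fv (Var x) = {x}"
| "fv (Sym s) = {}"
| "fv (Lam u) = {x. Suc x \<in> fv u}"
| "fv (App t u) = fv t \<union> fv u"
| "fv (Pr t u) = fv t \<union> fv u"
| "fv (Fst t) = fv t"
| "fv (Snd t) = fv t"
| "fv (LetIn t u) = fv t \<union> {x. Suc x \<in> fv u}"
| "fv (Ite t u v) = fv t \<union> fv u \<union> fv v"

primrec ren :: "(nat \<Rightarrow> nat) \<Rightarrow> 's tm \<Rightarrow> 's tm" where
  "ren \<rho> (Var x) = Var (\<rho> x)"
| "ren \<rho> (Sym s) = Sym s"
| "ren \<rho> (Lam u) = Lam (ren (case_nat 0 (\<lambda>x. Suc (\<rho> x))) u)"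
| "ren \<rho> (App t u) = App (ren \<rho> t) (ren \<rho> u)"
| "ren \<rho> (Pr t u) = Pr (ren \<rho> t) (ren \<rho> u)"
| "ren \<rho> (Fst t) = Fst (ren \<rho> t)"
| "ren \<rho> (Snd t) = Snd (ren \<rho> t)"
| "ren \<rho> (LetIn t u) = LetIn (ren \<rho> t) (ren (case_nat 0 (\<lambda>x. Suc (\<rho> x))) u)"
| "ren \<rho> (Ite t u v) = Ite (ren \<rho> t) (ren \<rho> u) (ren \<rho> v)"

definition up :: "(nat \<Rightarrow> 's tm) \<Rightarrow> nat \<Rightarrow> 's tm" where
  "up \<sigma> = case_nat (Var 0) (\<lambda>x. ren Suc (\<sigma> x))"

primrec subst :: "(nat \<Rightarrow> 's tm) \<Rightarrow> 's tm \<Rightarrow> 's tm" where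
  "subst \<sigma> (Var x) = \<sigma> x"
| "subst \<sigma> (Sym s) = Sym s"
| "subst \<sigma> (Lam u) = Lam (subst (up \<sigma>) u)"
| "subst \<sigma> (App t u) = App (subst \<sigma> t) (subst \<sigma> u)"
| "subst \<sigma> (Pr t u) = Pr (subst \<sigma> t) (subst \<sigma> u)"
| "subst \<sigma> (Fst t) = Fst (subst \<sigma> t)"
| "subst \<sigma> (Snd t) = Snd (subst \<sigma> t)"
| "subst \<sigma> (LetIn t u) = LetIn (subst \<sigma> t) (subst (up \<sigma>) u)"
| "subst \<sigma> (Ite t u v) = Ite (subst \<sigma> t) (subst \<sigma> u) (subst \<sigma> v)"

definition subst1 :: "'s tm \<Rightarrow> 's tm \<Rightarrow> 's tm" where
  "subst1 u t = subst (case_nat t Var) u"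


section \<open>Conditional rewriting\<close>

text \<open>
  A rule \<open>(cs, l, r)\<close> has the conditions \<open>t = true\<close> for \<open>(t, True)\<close> in \<open>cs\<close> and
  \<open>t = false\<close> for \<open>(t, False)\<close> in \<open>cs\<close>. The elements of \<open>funs\<close> are the function symbols,
  all other elements of \<open>'s\<close> are the constructor symbols.
\<close>

type_synonym 's rule = "('s tm \<times> bool) list \<times> 's tm \<times> 's tm"

record 's crs =
  tru :: 's
  fls :: 's
  funs :: "'s set"
  rules :: "'s rule set"

abbreviation bool_tm :: "'s crs \<Rightarrow> bool \<Rightarrow> 's tm" where
  "bool_tm R b \<equiv> Sym (if b then tru R else fls R)"

inductive pattern :: "'s crs \<Rightarrow> 's tm \<Rightarrow> bool" for R where
  "pattern R (Var x)"
| "c \<notin> funs R \<Longrightarrow> (\<forall>p\<in>set ps. pattern R p) \<Longrightarrow> pattern R (apps (Sym c) ps)"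

definition wf_rule :: "'s crs \<Rightarrow> 's rule \<Rightarrow> bool" where
  "wf_rule R rl \<longleftrightarrow> (case rl of (cs, l, r) \<Rightarrow>
     (\<exists>f\<in>funs R. \<exists>ls. l = apps (Sym f) ls \<and> (\<forall>p\<in>set ls. pattern R p)) \<and>
     fv r \<subseteq> fv l \<and> (\<forall>(t, c)\<in>set cs. fv t \<subseteq> fv l))"

text \<open>One-hole contexts; plugging may capture variables.\<close>

datatype 's ctxt =
    Hole
  | CLam "'s ctxt"
  | CAppL "'s ctxt" "'s tm" | CAppR "'s tm" "'s ctxt"
  | CPrL "'s ctxt" "'s tm" | CPrR "'s tm" "'s ctxt"
  | CFst "'s ctxt"
  | CSnd "'s ctxt"
  | CLetL "'s ctxt" "'s tm" | CLetR "'s tm" "'s ctxt"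
  | CIte1 "'s ctxt" "'s tm" "'s tm" | CIte2 "'s tm" "'s ctxt" "'s tm"
  | CIte3 "'s tm" "'s tm" "'s ctxt"

primrec plug :: "'s ctxt \<Rightarrow> 's tm \<Rightarrow> 's tm" where
  "plug Hole t = t"
| "plug (CLam K) t = Lam (plug K t)"
| "plug (CAppL K u) t = App (plug K t) u"
| "plug (CAppR u K) t = App u (plug K t)"
| "plug (CPrL K u) t = Pr (plug K t) u"
| "plug (CPrR u K) t = Pr u (plug K t)"
| "plug (CFst K) t = Fst (plug K t)"
| "plug (CSnd K) t = Snd (plug K t)"
| "plug (CLetL K u) t = LetIn (plug K t) u"
| "plug (CLetR u K) t = LetIn u (plug K t)"
| "plug (CIte1 K u v) t = Ite (plug K t) u v"
| "plug (CIte2 u K v) t = Ite u (plug K t) v"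
| "plug (CIte3 u v K) t = Ite u v (plug K t)"

inductive elim_ctxt :: "'s ctxt \<Rightarrow> bool" where
  "elim_ctxt Hole"
| "elim_ctxt E \<Longrightarrow> elim_ctxt (CAppL E t)"
| "elim_ctxt E \<Longrightarrow> elim_ctxt (CFst E)"
| "elim_ctxt E \<Longrightarrow> elim_ctxt (CSnd E)"

inductive betah :: "'s crs \<Rightarrow> 's tm \<Rightarrow> 's tm \<Rightarrow> bool" for R where
  "betah R (App (Lam u) t) (subst1 u t)"
| "betah R (LetIn t u) (subst1 u t)"
| "betah R (Fst (Pr u v)) u"
| "betah R (Snd (Pr u v)) v"
| "betah R (Ite (bool_tm R True) u v) u"
| "betah R (Ite (bool_tm R False) u v) v"

inductive beta :: "'s crs \<Rightarrow> 's tm \<Rightarrow> 's tm \<Rightarrow> bool" for R where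
  "betah R t u \<Longrightarrow> beta R (plug K t) (plug K u)"

inductive redR :: "'s crs \<Rightarrow> 's tm \<Rightarrow> 's tm \<Rightarrow> bool" for R where
  rule: "(cs, l, r) \<in> rules R \<Longrightarrow>
    (\<forall>(t, c)\<in>set cs. (\<lambda>a b. beta R a b \<or> redR R a b)\<^sup>*\<^sup>* (subst \<sigma> t) (bool_tm R c)) \<Longrightarrow>
    redR R (subst \<sigma> l) (subst \<sigma> r)"
| ctxt: "redR R t u \<Longrightarrow> redR R (plug K t) (plug K u)"
| subst: "redR R t u \<Longrightarrow> redR R (subst \<sigma> t) (subst \<sigma> u)"

definition red :: "'s crs \<Rightarrow> 's tm \<Rightarrow> 's tm \<Rightarrow> bool" where
  "red R t u \<longleftrightarrow> beta R t u \<or> redR R t u"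

definition locally_confluent :: "('a \<Rightarrow> 'a \<Rightarrow> bool) \<Rightarrow> bool" where
  "locally_confluent r \<longleftrightarrow>
     (\<forall>t u v. r t u \<longrightarrow> r t v \<longrightarrow> (\<exists>w. r\<^sup>*\<^sup>* u w \<and> r\<^sup>*\<^sup>* v w))"

definition rewrite_system :: "'s crs \<Rightarrow> bool" where
  "rewrite_system R \<longleftrightarrow>
     tru R \<noteq> fls R \<and> tru R \<notin> funs R \<and> fls R \<notin> funs R \<and>
     (\<forall>rl\<in>rules R. wf_rule R rl) \<and> locally_confluent (red R)"

definition SN :: "'s crs \<Rightarrow> 's tm set" where
  "SN R = {t. termip (red R) t}"

definition nf :: "'s crs \<Rightarrow> 's tm \<Rightarrow> 's tm" where
  "nf R t = (THE u. (red R)\<^sup>*\<^sup>* t u \<and> (\<nexists>v. red R u v))"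


section \<open>Saturated sets and interpretation of types\<close>

definition SAT :: "'s crs \<Rightarrow> 's tm set set" where
  "SAT R = {S.
     S \<subseteq> SN R \<and>
     (\<forall>t t'. t \<in> S \<longrightarrow> red R t t' \<longrightarrow> t' \<in> S) \<and>
     (\<forall>E x. elim_ctxt E \<longrightarrow> plug E (Var x) \<in> SN R \<longrightarrow> plug E (Var x) \<in> S) \<and>
     (\<forall>E t t'. elim_ctxt E \<longrightarrow> t \<in> SN R \<longrightarrow> betah R t t' \<longrightarrow> plug E t' \<in> S \<longrightarrow> plug E t \<in> S)}"

definition fun_set :: "'s tm set \<Rightarrow> 's tm set \<Rightarrow> 's tm set" where
  "fun_set S1 S2 = {t. \<forall>u\<in>S1. App t u \<in> S2}"

definition prod_set :: "'s tm set \<Rightarrow> 's tm set \<Rightarrow> 's tm set" where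
  "prod_set S1 S2 = {t. Fst t \<in> S1 \<and> Snd t \<in> S2}"

inductive neutral :: "'s crs \<Rightarrow> 's tm \<Rightarrow> bool" for R where
  "f \<in> funs R \<Longrightarrow> neutral R (apps (Sym f) ts)"
| "neutral R (Ite t u v)"
| "neutral R (Fst t)"
| "neutral R (Snd t)"

definition neutral_term_property :: "'s crs \<Rightarrow> 's tm set \<Rightarrow> bool" where
  "neutral_term_property R S \<longleftrightarrow>
     (\<forall>s. neutral R s \<longrightarrow> (\<forall>s'. red R s s' \<longrightarrow> s' \<in> S) \<longrightarrow> s \<in> S)"

definition base_type_interp :: "'s crs \<Rightarrow> ('b \<Rightarrow> 'd \<Rightarrow> 's tm set) \<Rightarrow> bool" where
  "base_type_interp R I \<longleftrightarrow> (\<forall>B \<kappa>. I B \<kappa> \<in> SAT R)"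

text \<open>
  The intersection and the union are taken over the extensions of the current valuation
  \<open>\<mu>\<close> that satisfy \<open>P\<close>; if there are none, the values are \<^term>\<open>SN R\<close> and
  \<^term>\<open>\<Inter>(SAT R)\<close>. This case distinction has to refer to \<open>\<mu>\<close> and not to all valuations:
  the typing rules only ensure that \<open>P\<close> is satisfiable under the constraint of the
  judgement, which need not hold at every valuation. Both agree if the existential closure
  of \<open>P\<close> over the bound variables is valid (see the lemmas below), in particular for
  \<open>\<exists>\<close>-basic types.
\<close>

primrec interp ::
  "('g, 'd) size_alg \<Rightarrow> 's crs \<Rightarrow> ('b \<Rightarrow> 'd \<Rightarrow> 's tm set) \<Rightarrow> 'd valn \<Rightarrow> ('b, 'g) ty \<Rightarrow> 's tm set"
where
  "interp A R I \<mu> (TBool a) = {t \<in> SN R. nf R t \<noteq> bool_tm R (\<not> beval A \<mu> a)}"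
| "interp A R I \<mu> (TBase B a) = I B (neval A \<mu> a)"
| "interp A R I \<mu> (Arr U V) = fun_set (interp A R I \<mu> U) (interp A R I \<mu> V)"
| "interp A R I \<mu> (Prod U V) = prod_set (interp A R I \<mu> U) (interp A R I \<mu> V)"
| "interp A R I \<mu> (TAll m n P T) =
     (if sat A \<mu> (CEx m n P)
      then \<Inter>\<kappa>\<in>{\<kappa>. sat A (ext_valn m n \<kappa> \<mu>) P}. interp A R I (ext_valn m n \<kappa> \<mu>) T
      else SN R)"
| "interp A R I \<mu> (TEx m n P T) =
     (if sat A \<mu> (CEx m n P)
      then \<Union>\<kappa>\<in>{\<kappa>. sat A (ext_valn m n \<kappa> \<mu>) P}. interp A R I (ext_valn m n \<kappa> \<mu>) T
      else \<Inter>(SAT R))"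

lemma interp_TAll_valid:
  assumes "valid A (CEx m n P)"
  shows "interp A R I \<mu> (TAll m n P T) =
    (\<Inter>\<kappa>\<in>{\<kappa>. sat A (ext_valn m n \<kappa> \<mu>) P}. interp A R I (ext_valn m n \<kappa> \<mu>) T)"
proof -
  have "sat A \<mu> (CEx m n P)" using assms unfolding valid_def by blast
  then show ?thesis by (simp only: interp.simps if_True)
qed

lemma interp_TEx_valid:
  assumes "valid A (CEx m n P)"
  shows "interp A R I \<mu> (TEx m n P T) =
    (\<Union>\<kappa>\<in>{\<kappa>. sat A (ext_valn m n \<kappa> \<mu>) P}. interp A R I (ext_valn m n \<kappa> \<mu>) T)"
proof -
  have "sat A \<mu> (CEx m n P)" using assms unfolding valid_def by blast
  then show ?thesis by (simp only: interp.simps if_True)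
qed


section \<open>Typing\<close>

definition type_assignment ::
  "('g, 'd) size_alg \<Rightarrow> 's crs \<Rightarrow> ('s \<Rightarrow> ('b, 'g) ty) \<Rightarrow> bool" where
  "type_assignment A R \<tau> \<longleftrightarrow>
     (\<forall>s. is_type A (\<tau> s) \<and> tclosed 0 0 (\<tau> s)) \<and>
     \<tau> (tru R) = TBool TT \<and> \<tau> (fls R) = TBool FF"

type_synonym ('b, 'g) env = "nat \<Rightarrow> ('b, 'g) ty option"

definition environment :: "('g, 'd) size_alg \<Rightarrow> ('b, 'g) env \<Rightarrow> bool" where
  "environment A \<Gamma> \<longleftrightarrow> finite (dom \<Gamma>) \<and> (\<forall>T\<in>ran \<Gamma>. is_type A T)"

text \<open>\<open>extend \<Gamma> T\<close> declares the term variable 0 bound by \<open>Lam\<close> or \<open>LetIn\<close>.\<close>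

definition extend :: "('b, 'g) env \<Rightarrow> ('b, 'g) ty \<Rightarrow> ('b, 'g) env" where
  "extend \<Gamma> T = case_nat (Some T) \<Gamma>"

definition env_shift :: "nat \<Rightarrow> nat \<Rightarrow> ('b, 'g) env \<Rightarrow> ('b, 'g) env" where
  "env_shift m n \<Gamma> = (\<lambda>x. map_option (tsub (shift m n)) (\<Gamma> x))"

text \<open>
  The freshness conditions on size variables are expressed by shifting \<open>C\<close>, \<open>\<Gamma>\<close> and \<open>U\<close>
  under the binder.
\<close>

inductive typing ::
  "('g, 'd) size_alg \<Rightarrow> ('s \<Rightarrow> ('b, 'g) ty) \<Rightarrow>
   'g constr \<Rightarrow> ('b, 'g) env \<Rightarrow> 's tm \<Rightarrow> ('b, 'g) ty \<Rightarrow> bool"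
  for A \<tau> where
  var: "\<Gamma> x = Some T \<Longrightarrow> typing A \<tau> C \<Gamma> (Var x) T"
| symb: "typing A \<tau> C \<Gamma> (Sym s) (\<tau> s)"
| abs: "is_type A T \<Longrightarrow> typing A \<tau> C (extend \<Gamma> T) u U \<Longrightarrow> typing A \<tau> C \<Gamma> (Lam u) (Arr T U)"
| app: "typing A \<tau> C \<Gamma> t (Arr U V) \<Longrightarrow> typing A \<tau> C \<Gamma> u U \<Longrightarrow> typing A \<tau> C \<Gamma> (App t u) V"
| pair: "typing A \<tau> C \<Gamma> u U \<Longrightarrow> typing A \<tau> C \<Gamma> v V \<Longrightarrow> typing A \<tau> C \<Gamma> (Pr u v) (Prod U V)"
| fst: "typing A \<tau> C \<Gamma> t (Prod U V) \<Longrightarrow> typing A \<tau> C \<Gamma> (Fst t) U"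
| snd: "typing A \<tau> C \<Gamma> t (Prod U V) \<Longrightarrow> typing A \<tau> C \<Gamma> (Snd t) V"
| ite: "typing A \<tau> C \<Gamma> t (TEx 0 1 CTop (TBool (BVar 0))) \<Longrightarrow>
    typing A \<tau> C \<Gamma> u T \<Longrightarrow> typing A \<tau> C \<Gamma> v T \<Longrightarrow> ex_basic A T \<Longrightarrow>
    typing A \<tau> C \<Gamma> (Ite t u v) T"
| letin: "typing A \<tau> C \<Gamma> t T \<Longrightarrow> typing A \<tau> C (extend \<Gamma> T) u U \<Longrightarrow>
    typing A \<tau> C \<Gamma> (LetIn t u) U"
| all_intro: "P \<in> cclass A \<Longrightarrow>
    typing A \<tau> (CAnd (csub (shift m n) C) P) (env_shift m n \<Gamma>) t T \<Longrightarrow>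
    valid A (CImp C (CEx m n P)) \<Longrightarrow>
    typing A \<tau> C \<Gamma> t (TAll m n P T)"
| all_elim: "typing A \<tau> C \<Gamma> t (TAll m n P T) \<Longrightarrow>
    valid A (CImp C (csub (inst_ssub m n a) P)) \<Longrightarrow>
    typing A \<tau> C \<Gamma> t (tsub (inst_ssub m n a) T)"
| ex_intro: "is_type A (TEx m n P T) \<Longrightarrow>
    typing A \<tau> C \<Gamma> t (tsub (inst_ssub m n a) T) \<Longrightarrow>
    valid A (CImp C (csub (inst_ssub m n a) P)) \<Longrightarrow>
    typing A \<tau> C \<Gamma> t (TEx m n P T)"
| ex_elim: "typing A \<tau> C \<Gamma> t (TEx m n P T) \<Longrightarrow>
    typing A \<tau> (CAnd (csub (shift m n) C) P) (extend (env_shift m n \<Gamma>) T)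
      u (tsub (shift m n) U) \<Longrightarrow>
    valid A (CImp C (CEx m n P)) \<Longrightarrow>
    typing A \<tau> C \<Gamma> (LetIn t u) U"
| sub: "is_type A T' \<Longrightarrow> typing A \<tau> C \<Gamma> t T \<Longrightarrow> subtype A C T T' \<Longrightarrow> typing A \<tau> C \<Gamma> t T'"


section \<open>Computability and validity\<close>

text \<open>The type of a symbol is closed, so the choice of the valuation is immaterial.\<close>

definition computable ::
  "('g, 'd) size_alg \<Rightarrow> 's crs \<Rightarrow> ('s \<Rightarrow> ('b, 'g) ty) \<Rightarrow> ('b \<Rightarrow> 'd \<Rightarrow> 's tm set) \<Rightarrow> 's \<Rightarrow> bool"
where
  "computable A R \<tau> I s \<longleftrightarrow> (\<forall>\<mu>. Sym s \<in> interp A R I \<mu> (\<tau> s))"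

definition valid_interp ::
  "('g, 'd) size_alg \<Rightarrow> 's crs \<Rightarrow> ('s \<Rightarrow> ('b, 'g) ty) \<Rightarrow> ('b \<Rightarrow> 'd \<Rightarrow> 's tm set) \<Rightarrow> bool"
where
  "valid_interp A R \<tau> I \<longleftrightarrow>
     (\<forall>c. c \<notin> funs R \<longrightarrow> computable A R \<tau> I c) \<and>
     (\<forall>T \<mu>. ex_basic A T \<longrightarrow> neutral_term_property R (interp A R I \<mu> T))"

definition models ::
  "('g, 'd) size_alg \<Rightarrow> 's crs \<Rightarrow> ('b \<Rightarrow> 'd \<Rightarrow> 's tm set) \<Rightarrow> 'd valn \<Rightarrow> (nat \<Rightarrow> 's tm) \<Rightarrow>
   'g constr \<Rightarrow> ('b, 'g) env \<Rightarrow> bool"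
where
  "models A R I \<mu> \<sigma> C \<Gamma> \<longleftrightarrow>
     sat A \<mu> C \<and> (\<forall>x T. \<Gamma> x = Some T \<longrightarrow> \<sigma> x \<in> interp A R I \<mu> T)"

end

theory Submission
  imports Defs
begin

text \<open>
  Every type is interpreted by a saturated set, so expansion along head-\<open>\<beta>\<close> steps handles the
  introduction rules, and the interpretation is stable under substitution of size expressions:
  substituting in the type amounts to updating the valuation. Subtyping constraints that hold at
  a valuation therefore give inclusions of interpretations at this valuation, and the theorem
  follows by induction on typing derivations, for all valuations and substitutions at once. Only
  conditionals need more than saturation, namely the neutral term property.
\<close>

section \<open>Substitution\<close>

text \<open>The obstacle is that \<open>SN R\<close> must itself be saturated: head expansion inside
  elimination contexts has to preserve termination in the presence of conditional rules. What makes
  this work is that left-hand sides are headed by function symbols. A rule never fires at the root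
  of a head-beta redex, nor at the root of an elimination context filled with one, so the
  contraction commutes with every other step. Local confluence enters only through uniqueness of
  normal forms, that is, for the interpretation of \<open>Bool\<close>. The values chosen for
  binders that are unsatisfiable at the current valuation are the largest and the least saturated
  set; hence quantified types stay saturated and subtyping stays sound there, while eliminating an
  existential relies on the satisfiability premise of its rule to obtain a witness.\<close>

lemma subst_ren: "subst \<sigma> (ren \<rho> t) = subst (\<lambda>x. \<sigma> (\<rho> x)) t"
proof (induction t arbitrary: \<sigma> \<rho>)
  case (Lam t)
  have "(\<lambda>x. up \<sigma> (case_nat 0 (\<lambda>x. Suc (\<rho> x)) x)) = up (\<lambda>x. \<sigma> (\<rho> x))"
    by (rule ext) (auto simp: up_def split: nat.split)
  then show ?case by (simp add: Lam)
next
  case (LetIn t u)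
  have "(\<lambda>x. up \<sigma> (case_nat 0 (\<lambda>x. Suc (\<rho> x)) x)) = up (\<lambda>x. \<sigma> (\<rho> x))"
    by (rule ext) (auto simp: up_def split: nat.split)
  then show ?case by (simp add: LetIn)
qed auto

lemma ren_ren: "ren \<rho> (ren \<rho>' t) = ren (\<lambda>x. \<rho> (\<rho>' x)) t"
proof (induction t arbitrary: \<rho> \<rho>')
  case (Lam t)
  have "(\<lambda>x. case_nat 0 (\<lambda>x. Suc (\<rho> x)) (case_nat 0 (\<lambda>x. Suc (\<rho>' x)) x)) =
      case_nat 0 (\<lambda>x. Suc (\<rho> (\<rho>' x)))"
    by (rule ext) (auto split: nat.split)
  then show ?case by (simp add: Lam)
next
  case (LetIn t u)
  have "(\<lambda>x. case_nat 0 (\<lambda>x. Suc (\<rho> x)) (case_nat 0 (\<lambda>x. Suc (\<rho>' x)) x)) =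
      case_nat 0 (\<lambda>x. Suc (\<rho> (\<rho>' x)))"
    by (rule ext) (auto split: nat.split)
  then show ?case by (simp add: LetIn)
qed auto

lemma ren_subst: "ren \<rho> (subst \<sigma> t) = subst (\<lambda>x. ren \<rho> (\<sigma> x)) t"
proof (induction t arbitrary: \<sigma> \<rho>)
  case (Lam t)
  have "(\<lambda>x. ren (case_nat 0 (\<lambda>x. Suc (\<rho> x))) (up \<sigma> x)) = up (\<lambda>x. ren \<rho> (\<sigma> x))"
    by (rule ext) (auto simp: up_def ren_ren split: nat.split)
  then show ?case by (simp add: Lam)
next
  case (LetIn t u)
  have "(\<lambda>x. ren (case_nat 0 (\<lambda>x. Suc (\<rho> x))) (up \<sigma> x)) = up (\<lambda>x. ren \<rho> (\<sigma> x))"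
    by (rule ext) (auto simp: up_def ren_ren split: nat.split)
  then show ?case by (simp add: LetIn)
qed auto

text \<open>Under a binder the images of \<open>\<theta>\<close> are renamed by \<open>Suc\<close>,
  so this composition law rests on those that mix renaming and substitution.\<close>

lemma subst_subst: "subst \<sigma> (subst \<theta> t) = subst (\<lambda>x. subst \<sigma> (\<theta> x)) t"
proof (induction t arbitrary: \<sigma> \<theta>)
  case (Lam t)
  have "(\<lambda>x. subst (up \<sigma>) (up \<theta> x)) = up (\<lambda>x. subst \<sigma> (\<theta> x))"
    by (rule ext) (auto simp: up_def subst_ren ren_subst split: nat.split)
  then show ?case by (simp add: Lam)
next
  case (LetIn t u)
  have "(\<lambda>x. subst (up \<sigma>) (up \<theta> x)) = up (\<lambda>x. subst \<sigma> (\<theta> x))"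
    by (rule ext) (auto simp: up_def subst_ren ren_subst split: nat.split)
  then show ?case by (simp add: LetIn)
qed auto

lemma up_Var: "up Var = Var"
  by (rule ext) (auto simp: up_def split: nat.split)

lemma subst_Var: "subst Var t = t"
  by (induction t) (auto simp: up_Var)

lemma ren_eq_subst: "ren \<rho> t = subst (\<lambda>x. Var (\<rho> x)) t"
  using ren_subst[of \<rho> Var t] by (simp add: subst_Var)

text \<open>Links contraction to the typing induction: below a binder the induction hypothesis
  speaks about \<open>case_nat s \<sigma>\<close>, whereas a head-beta step produces the left-hand
  side.\<close>

lemma subst1_up: "subst1 (subst (up \<sigma>) u) s = subst (case_nat s \<sigma>) u"
proof -
  have "(\<lambda>x. subst (case_nat s Var) (up \<sigma> x)) = case_nat s \<sigma>"
    by (rule ext) (auto simp: up_def subst_ren subst_Var split: nat.split)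
  then show ?thesis by (simp add: subst1_def subst_subst)
qed

lemma subst_subst1: "subst \<sigma> (subst1 u t) = subst1 (subst (up \<sigma>) u) (subst \<sigma> t)"
proof -
  have "(\<lambda>x. subst \<sigma> (case_nat t Var x)) = case_nat (subst \<sigma> t) \<sigma>"
    by (rule ext) (auto split: nat.split)
  then show ?thesis by (simp add: subst1_up) (simp add: subst1_def subst_subst)
qed


section \<open>Reduction\<close>

text \<open>The conditions refer to the relation \<open>red\<close> that is already defined, so
  \<open>step\<close> below does not recur through them.\<close>

definition rstep :: "'s crs \<Rightarrow> 's tm \<Rightarrow> 's tm \<Rightarrow> bool" where
  "rstep R t u \<longleftrightarrow> (\<exists>cs l r \<sigma>. (cs, l, r) \<in> rules R \<and>
     (\<forall>(a, c)\<in>set cs. (red R)\<^sup>*\<^sup>* (subst \<sigma> a) (bool_tm R c)) \<and> t = subst \<sigma> l \<and> u = subst \<sigma> r)"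

text \<open>
  The closure of \<^const>\<open>redR\<close> under contexts and substitutions is part of its definition and
  cannot be inverted; \<open>step\<close> is the same relation, presented by congruence rules.
\<close>

inductive step :: "'s crs \<Rightarrow> 's tm \<Rightarrow> 's tm \<Rightarrow> bool" for R where
  betah: "betah R t u \<Longrightarrow> step R t u"
| rstep: "rstep R t u \<Longrightarrow> step R t u"
| Lam: "step R t t' \<Longrightarrow> step R (Lam t) (Lam t')"
| AppL: "step R t t' \<Longrightarrow> step R (App t u) (App t' u)"
| AppR: "step R u u' \<Longrightarrow> step R (App t u) (App t u')"
| PrL: "step R t t' \<Longrightarrow> step R (Pr t u) (Pr t' u)"
| PrR: "step R u u' \<Longrightarrow> step R (Pr t u) (Pr t u')"
| Fst: "step R t t' \<Longrightarrow> step R (Fst t) (Fst t')"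
| Snd: "step R t t' \<Longrightarrow> step R (Snd t) (Snd t')"
| LetL: "step R t t' \<Longrightarrow> step R (LetIn t u) (LetIn t' u)"
| LetR: "step R u u' \<Longrightarrow> step R (LetIn t u) (LetIn t u')"
| Ite1: "step R t t' \<Longrightarrow> step R (Ite t u v) (Ite t' u v)"
| Ite2: "step R u u' \<Longrightarrow> step R (Ite t u v) (Ite t u' v)"
| Ite3: "step R v v' \<Longrightarrow> step R (Ite t u v) (Ite t u v')"

lemma step_plug: "step R t u \<Longrightarrow> step R (plug K t) (plug K u)"
  by (induction K) (auto intro: step.intros)

lemma betah_subst: "betah R t u \<Longrightarrow> betah R (subst \<sigma> t) (subst \<sigma> u)"
  by (induction rule: betah.induct)
    (auto simp: subst_subst1 intro: betah.intros betah.intros(5,6)[simplified])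

fun ctxt_subst :: "(nat \<Rightarrow> 's tm) \<Rightarrow> 's ctxt \<Rightarrow> 's ctxt" where
  "ctxt_subst \<sigma> Hole = Hole"
| "ctxt_subst \<sigma> (CLam K) = CLam (ctxt_subst (up \<sigma>) K)"
| "ctxt_subst \<sigma> (CAppL K u) = CAppL (ctxt_subst \<sigma> K) (subst \<sigma> u)"
| "ctxt_subst \<sigma> (CAppR u K) = CAppR (subst \<sigma> u) (ctxt_subst \<sigma> K)"
| "ctxt_subst \<sigma> (CPrL K u) = CPrL (ctxt_subst \<sigma> K) (subst \<sigma> u)"
| "ctxt_subst \<sigma> (CPrR u K) = CPrR (subst \<sigma> u) (ctxt_subst \<sigma> K)"
| "ctxt_subst \<sigma> (CFst K) = CFst (ctxt_subst \<sigma> K)"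
| "ctxt_subst \<sigma> (CSnd K) = CSnd (ctxt_subst \<sigma> K)"
| "ctxt_subst \<sigma> (CLetL K u) = CLetL (ctxt_subst \<sigma> K) (subst (up \<sigma>) u)"
| "ctxt_subst \<sigma> (CLetR u K) = CLetR (subst \<sigma> u) (ctxt_subst (up \<sigma>) K)"
| "ctxt_subst \<sigma> (CIte1 K u v) = CIte1 (ctxt_subst \<sigma> K) (subst \<sigma> u) (subst \<sigma> v)"
| "ctxt_subst \<sigma> (CIte2 u K v) = CIte2 (subst \<sigma> u) (ctxt_subst \<sigma> K) (subst \<sigma> v)"
| "ctxt_subst \<sigma> (CIte3 u v K) = CIte3 (subst \<sigma> u) (subst \<sigma> v) (ctxt_subst \<sigma> K)"

text \<open>The substitution that reaches the hole is lifted once per binder on the way. It depends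
  on \<open>K\<close> but not on \<open>t\<close>, hence serves both sides of a step.\<close>

lemma subst_plug: "\<exists>\<sigma>'. \<forall>t. subst \<sigma> (plug K t) = plug (ctxt_subst \<sigma> K) (subst \<sigma>' t)"
  by (induction \<sigma> K rule: ctxt_subst.induct) auto

lemma beta_subst: "beta R t u \<Longrightarrow> beta R (subst \<sigma> t) (subst \<sigma> u)"
  by (auto elim!: beta.cases) (metis subst_plug betah_subst beta.intros)

lemma red_subst: "red R t u \<Longrightarrow> red R (subst \<sigma> t) (subst \<sigma> u)"
  unfolding red_def using beta_subst redR.subst by blast

lemma red_plug: "red R t u \<Longrightarrow> red R (plug K t) (plug K u)"
proof -
  \<comment> \<open>\<open>beta\<close> closes under one context only, so nested contexts have to be
    merged.\<close>
  have plug_plug: "\<exists>K''. \<forall>t. plug K (plug K' t) = plug K'' t" for K' :: "'a ctxt"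
  proof (induction K)
    case Hole then show ?case by (metis plug.simps(1))
  next case CLam then show ?case by (metis plug.simps(2))
  next case CAppL then show ?case by (metis plug.simps(3))
  next case CAppR then show ?case by (metis plug.simps(4))
  next case CPrL then show ?case by (metis plug.simps(5))
  next case CPrR then show ?case by (metis plug.simps(6))
  next case CFst then show ?case by (metis plug.simps(7))
  next case CSnd then show ?case by (metis plug.simps(8))
  next case CLetL then show ?case by (metis plug.simps(9))
  next case CLetR then show ?case by (metis plug.simps(10))
  next case CIte1 then show ?case by (metis plug.simps(11))
  next case CIte2 then show ?case by (metis plug.simps(12))
  next case CIte3 then show ?case by (metis plug.simps(13))
  qed
  assume "red R t u"
  then consider "beta R t u" | "redR R t u" unfolding red_def by blast
  then show ?thesis
  proof cases
    case 1
    then obtain K' t0 u0 where "t = plug K' t0" "u = plug K' u0" "betah R t0 u0"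
      by (auto elim: beta.cases)
    with plug_plug[of K'] show ?thesis unfolding red_def by (metis beta.intros)
  next
    case 2
    then show ?thesis unfolding red_def by (blast intro: redR.ctxt)
  qed
qed

lemma step_subst: "step R t u \<Longrightarrow> step R (subst \<sigma> t) (subst \<sigma> u)"
proof (induction arbitrary: \<sigma> rule: step.induct)
  case (rstep t u)
  then obtain cs l r \<theta> where *: "(cs, l, r) \<in> rules R"
    "\<forall>(a, c)\<in>set cs. (red R)\<^sup>*\<^sup>* (subst \<theta> a) (bool_tm R c)" "t = subst \<theta> l" "u = subst \<theta> r"
    unfolding rstep_def by blast
  have red_subst_star: "(red R)\<^sup>*\<^sup>* a b \<Longrightarrow> (red R)\<^sup>*\<^sup>* (subst \<sigma> a) (subst \<sigma> b)" for a b
    by (induction rule: rtranclp_induct) (auto intro: red_subst rtranclp.rtrancl_into_rtrancl)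
  \<comment> \<open>The instance \<open>\<sigma>\<close> after \<open>\<theta>\<close> of the same
    rule fires, since its conditions hold by stability of \<open>red\<close> under
    substitution.\<close>
  have "\<forall>(a, c)\<in>set cs. (red R)\<^sup>*\<^sup>* (subst \<sigma> (subst \<theta> a)) (bool_tm R c)"
    using *(2) red_subst_star by fastforce
  then have "rstep R (subst \<sigma> t) (subst \<sigma> u)"
    unfolding rstep_def subst_subst *(3,4) using *(1) by blast
  then show ?case by (rule step.rstep)
qed (auto intro: step.intros betah_subst)

lemma red_eq_step: "red R = step R"
proof (intro ext iffI)
  fix t u assume "red R t u"
  then show "step R t u" unfolding red_def
  proof
    assume "beta R t u"
    then show ?thesis by (auto elim!: beta.cases intro: step_plug step.betah)
  next
    assume "redR R t u"
    then show ?thesis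
    proof induction
      case (rule cs l r \<sigma>)
      have "(red R) = (\<lambda>a b. beta R a b \<or> redR R a b)" by (intro ext) (simp add: red_def)
      \<comment> \<open>Rule induction adds the claim as a conjunct under the closure in the
        conditions; monotonicity removes it again.\<close>
      with rule have "\<forall>(a, c)\<in>set cs. (red R)\<^sup>*\<^sup>* (subst \<sigma> a) (bool_tm R c)"
        by (fastforce elim: rtranclp_mono[THEN predicate2D, rotated])
      with rule have "rstep R (subst \<sigma> l) (subst \<sigma> r)"
        unfolding rstep_def by blast
      then show ?case by (rule step.rstep)
    qed (auto intro: step_plug step_subst)
  qed
next
  fix t u assume "step R t u"
  then show "red R t u"
  proof induction
    case (betah t u)
    then show ?case unfolding red_def using beta.intros[of R t u Hole] by simp
  next
    case (rstep t u)
    have "(red R) = (\<lambda>a b. beta R a b \<or> redR R a b)" by (intro ext) (simp add: red_def)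
    with rstep show ?case unfolding rstep_def red_def by (auto intro: redR.rule)
  next
    case (Lam t t') then show ?case using red_plug[of R _ _ "CLam Hole"] by simp
  next
    case (AppL t t' u) then show ?case using red_plug[of R _ _ "CAppL Hole u"] by simp
  next
    case (AppR u u' t) then show ?case using red_plug[of R _ _ "CAppR t Hole"] by simp
  next
    case (PrL t t' u) then show ?case using red_plug[of R _ _ "CPrL Hole u"] by simp
  next
    case (PrR u u' t) then show ?case using red_plug[of R _ _ "CPrR t Hole"] by simp
  next
    case (Fst t t') then show ?case using red_plug[of R _ _ "CFst Hole"] by simp
  next
    case (Snd t t') then show ?case using red_plug[of R _ _ "CSnd Hole"] by simp
  next
    case (LetL t t' u) then show ?case using red_plug[of R _ _ "CLetL Hole u"] by simp
  next
    case (LetR u u' t) then show ?case using red_plug[of R _ _ "CLetR t Hole"] by simp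
  next
    case (Ite1 t t' u v) then show ?case using red_plug[of R _ _ "CIte1 Hole u v"] by simp
  next
    case (Ite2 u u' t v) then show ?case using red_plug[of R _ _ "CIte2 t Hole v"] by simp
  next
    case (Ite3 v v' t u) then show ?case using red_plug[of R _ _ "CIte3 t u Hole"] by simp
  qed
qed

section \<open>Reduction sequences under contexts and substitutions\<close>

lemma steps_cong:
  assumes "(step R)\<^sup>*\<^sup>* t u" and "\<And>a b. step R a b \<Longrightarrow> step R (f a) (f b)"
  shows "(step R)\<^sup>*\<^sup>* (f t) (f u)"
  using assms(1) by induction (auto intro: assms(2) rtranclp.rtrancl_into_rtrancl)

lemma steps_plug: "(step R)\<^sup>*\<^sup>* t u \<Longrightarrow> (step R)\<^sup>*\<^sup>* (plug K t) (plug K u)"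
  by (erule steps_cong) (rule step_plug)

text \<open>A reduction in an image is repeated at each occurrence of the variable, so even a single
  step there can become any number of steps, including none.\<close>

lemma steps_subst_pointwise:
  assumes "\<And>x. (step R)\<^sup>*\<^sup>* (\<sigma> x) (\<theta> x)"
  shows "(step R)\<^sup>*\<^sup>* (subst \<sigma> t) (subst \<theta> t)"
  using assms
proof (induction t arbitrary: \<sigma> \<theta>)
  case (Var x)
  then show ?case by simp
next
  case (Sym s)
  then show ?case by simp
next
  case (Fst t)
  then show ?case using steps_plug[of R _ _ "CFst Hole"] by simp
next
  case (Snd t)
  then show ?case using steps_plug[of R _ _ "CSnd Hole"] by simp
next
  case (App t u)
  have "(step R)\<^sup>*\<^sup>* (App (subst \<sigma> t) (subst \<sigma> u)) (App (subst \<theta> t) (subst \<sigma> u))"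
    using steps_plug[OF App.IH(1)[OF App.prems], of "CAppL Hole _"] by simp
  moreover have "(step R)\<^sup>*\<^sup>* (App (subst \<theta> t) (subst \<sigma> u)) (App (subst \<theta> t) (subst \<theta> u))"
    using steps_plug[OF App.IH(2)[OF App.prems], of "CAppR _ Hole"] by simp
  ultimately show ?case by simp
next
  case (Pr t u)
  have "(step R)\<^sup>*\<^sup>* (Pr (subst \<sigma> t) (subst \<sigma> u)) (Pr (subst \<theta> t) (subst \<sigma> u))"
    using steps_plug[OF Pr.IH(1)[OF Pr.prems], of "CPrL Hole _"] by simp
  moreover have "(step R)\<^sup>*\<^sup>* (Pr (subst \<theta> t) (subst \<sigma> u)) (Pr (subst \<theta> t) (subst \<theta> u))"
    using steps_plug[OF Pr.IH(2)[OF Pr.prems], of "CPrR _ Hole"] by simp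
  ultimately show ?case by simp
next
  case (Ite t u v)
  let ?a = "\<lambda>\<sigma>. subst \<sigma> t" and ?b = "\<lambda>\<sigma>. subst \<sigma> u" and ?c = "\<lambda>\<sigma>. subst \<sigma> v"
  have "(step R)\<^sup>*\<^sup>* (Ite (?a \<sigma>) (?b \<sigma>) (?c \<sigma>)) (Ite (?a \<theta>) (?b \<sigma>) (?c \<sigma>))"
    using steps_plug[OF Ite.IH(1)[OF Ite.prems], of "CIte1 Hole _ _"] by simp
  also have "(step R)\<^sup>*\<^sup>* \<dots> (Ite (?a \<theta>) (?b \<theta>) (?c \<sigma>))"
    using steps_plug[OF Ite.IH(2)[OF Ite.prems], of "CIte2 _ Hole _"] by simp
  also have "(step R)\<^sup>*\<^sup>* \<dots> (Ite (?a \<theta>) (?b \<theta>) (?c \<theta>))"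
    using steps_plug[OF Ite.IH(3)[OF Ite.prems], of "CIte3 _ _ Hole"] by simp
  finally show ?case by simp
next
  case (Lam t)
  have "(step R)\<^sup>*\<^sup>* (up \<sigma> x) (up \<theta> x)" for x
    using Lam.prems
    by (cases x) (auto simp: up_def ren_eq_subst intro: steps_cong step_subst)
  from Lam.IH[OF this] show ?case using steps_plug[of R _ _ "CLam Hole"] by simp
next
  case (LetIn t u)
  have "(step R)\<^sup>*\<^sup>* (up \<sigma> x) (up \<theta> x)" for x
    using LetIn.prems
    by (cases x) (auto simp: up_def ren_eq_subst intro: steps_cong step_subst)
  note u = LetIn.IH(2)[OF this]
  have "(step R)\<^sup>*\<^sup>* (LetIn (subst \<sigma> t) (subst (up \<sigma>) u)) (LetIn (subst \<theta> t) (subst (up \<sigma>) u))"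
    using steps_plug[OF LetIn.IH(1)[OF LetIn.prems], of "CLetL Hole _"] by simp
  moreover have "(step R)\<^sup>*\<^sup>* (LetIn (subst \<theta> t) (subst (up \<sigma>) u))
      (LetIn (subst \<theta> t) (subst (up \<theta>) u))"
    using steps_plug[OF u, of "CLetR _ Hole"] by simp
  ultimately show ?case by simp
qed

lemma steps_subst1: "step R t t' \<Longrightarrow> (step R)\<^sup>*\<^sup>* (subst1 u t) (subst1 u t')"
  unfolding subst1_def by (rule steps_subst_pointwise) (auto split: nat.split)

lemma step_subst1: "step R u u' \<Longrightarrow> step R (subst1 u t) (subst1 u' t)"
  unfolding subst1_def by (rule step_subst)


section \<open>Heads of terms and the shapes of their reducts\<close>

fun head_tm :: "'s tm \<Rightarrow> 's tm" where
  "head_tm (App t u) = head_tm t"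
| "head_tm (Fst t) = head_tm t"
| "head_tm (Snd t) = head_tm t"
| "head_tm t = t"

lemma head_tm_plug: "elim_ctxt E \<Longrightarrow> head_tm (plug E t) = head_tm t"
  by (induction rule: elim_ctxt.induct) auto

lemma head_tm_apps: "head_tm (subst \<sigma> (apps t ts)) = head_tm (subst \<sigma> t)"
  by (induction ts arbitrary: t) auto

text \<open>Heads separate the two kinds of root redexes: an instance of a left-hand side keeps its
  function symbol, whereas a head-beta redex is headed by an abstraction, a pair, a
  \<open>LetIn\<close> or an \<open>Ite\<close>.\<close>

lemma head_tm_rstep:
  assumes "rewrite_system R" and "rstep R t u"
  shows "\<exists>f\<in>funs R. head_tm t = Sym f"
  using assms unfolding rstep_def rewrite_system_def wf_rule_def
  by (fastforce simp: head_tm_apps)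

lemma head_tm_betah:
  assumes "betah R t u"
  shows "head_tm t \<noteq> Sym s" "head_tm t \<noteq> Var x" "t \<noteq> Lam v" "t \<noteq> Pr v w"
  using assms by (auto elim: betah.cases)

lemma head_tm_step_Var:
  "step R t u \<Longrightarrow> rewrite_system R \<Longrightarrow> head_tm t = Var x \<Longrightarrow> head_tm u = Var x"
  by (induction rule: step.induct) (auto dest: head_tm_betah head_tm_rstep)

inductive_cases betah_IteE: "betah R (Ite t u v) s"
inductive_cases step_SymE: "step R (Sym f) s"
inductive_cases step_LamE: "step R (Lam t) s"
inductive_cases step_PrE: "step R (Pr t u) s"
inductive_cases step_AppE: "step R (App t u) s"
inductive_cases step_FstE: "step R (Fst t) s"
inductive_cases step_SndE: "step R (Snd t) s"
inductive_cases step_LetInE: "step R (LetIn t u) s"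
inductive_cases step_IteE: "step R (Ite t u v) s"

lemma step_Sym_cases:
  assumes "rewrite_system R" and "step R (Sym f) s"
  shows "f \<in> funs R"
  using assms(2) head_tm_rstep[OF assms(1)]
  by (cases rule: step_SymE) (fastforce elim: betah.cases)+

lemma step_Lam_cases:
  assumes "rewrite_system R" and "step R (Lam t) s"
  obtains t' where "step R t t'" "s = Lam t'"
  using assms(2) head_tm_rstep[OF assms(1)]
  by (cases rule: step_LamE) (fastforce elim: betah.cases)+

lemma step_Pr_cases:
  assumes "rewrite_system R" and "step R (Pr t u) s"
  obtains t' where "step R t t'" "s = Pr t' u" | u' where "step R u u'" "s = Pr t u'"
  using assms(2) head_tm_rstep[OF assms(1)]
  by (cases rule: step_PrE) (fastforce elim: betah.cases)+

text \<open>The alternative for rewrite rules records only the head and says nothing on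
  \<open>s\<close>: it is used for terms with another head, where this refutes it.\<close>

lemma step_App_cases:
  assumes "rewrite_system R" and "step R (App t u) s"
  obtains t' where "step R t t'" "s = App t' u" | u' where "step R u u'" "s = App t u'"
  | v where "t = Lam v" "s = subst1 v u" | f where "f \<in> funs R" "head_tm t = Sym f"
  using assms(2) head_tm_rstep[OF assms(1)]
  by (cases rule: step_AppE) (fastforce elim: betah.cases)+

lemma step_Fst_cases:
  assumes "rewrite_system R" and "step R (Fst t) s"
  obtains t' where "step R t t'" "s = Fst t'" | u where "t = Pr s u"
  | f where "f \<in> funs R" "head_tm t = Sym f"
  using assms(2) head_tm_rstep[OF assms(1)]
  by (cases rule: step_FstE) (fastforce elim: betah.cases)+

lemma step_Snd_cases:
  assumes "rewrite_system R" and "step R (Snd t) s"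
  obtains t' where "step R t t'" "s = Snd t'" | u where "t = Pr u s"
  | f where "f \<in> funs R" "head_tm t = Sym f"
  using assms(2) head_tm_rstep[OF assms(1)]
  by (cases rule: step_SndE) (fastforce elim: betah.cases)+

lemma step_LetIn_cases:
  assumes "rewrite_system R" and "step R (LetIn t u) s"
  obtains t' where "step R t t'" "s = LetIn t' u" | u' where "step R u u'" "s = LetIn t u'"
  | "s = subst1 u t"
  using assms(2) head_tm_rstep[OF assms(1)]
  by (cases rule: step_LetInE) (fastforce elim: betah.cases)+

lemma step_Ite_cases:
  assumes "rewrite_system R" and "step R (Ite t u v) s"
  obtains t' where "step R t t'" "s = Ite t' u v" | u' where "step R u u'" "s = Ite t u' v"
  | v' where "step R v v'" "s = Ite t u v'"
  | b where "t = bool_tm R b" "s = (if b then u else v)"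
  using assms(2) head_tm_rstep[OF assms(1)] that(4)[of True] that(4)[of False] that(1-3)
  by (cases rule: step_IteE) (fastforce elim: betah_IteE)+

lemma step_bool_tm: "rewrite_system R \<Longrightarrow> \<not> step R (bool_tm R b) s"
  using step_Sym_cases[of R "if b then tru R else fls R" s]
  by (auto simp: rewrite_system_def split: if_splits)

text \<open>No rule applies at the root, so a step other than the contraction lies inside a
  component. It survives the contraction, which may copy or erase it; hence the sequence from
  \<open>t'\<close>.\<close>

lemma betah_step_commute:
  assumes R: "rewrite_system R" and "betah R t t'" and "step R t t''" and "t'' \<noteq> t'"
  shows "\<exists>s. betah R t'' s \<and> (step R)\<^sup>*\<^sup>* t' s"
  using assms(2)
proof cases
  case (1 u v)
  from assms(3)[unfolded 1] show ?thesis
  proof (cases rule: step_App_cases[OF R, consumes 1])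
    case (1 w)
    from 1(1) obtain u' where "step R u u'" "w = Lam u'" by (rule step_Lam_cases[OF R])
    with 1(2) \<open>t' = _\<close> show ?thesis
      using betah.intros(1)[of R u' v] step_subst1[of R u u' v] by blast
  next
    case (2 v')
    with \<open>t' = _\<close> show ?thesis
      using betah.intros(1)[of R u v'] steps_subst1[of R v v' u] by blast
  qed (use 1 assms(4) in auto)
next
  case (2 v u)
  from assms(3)[unfolded 2] show ?thesis
  proof (cases rule: step_LetIn_cases[OF R, consumes 1])
    case (1 v')
    with 2 show ?thesis using betah.intros(2)[of R v' u] steps_subst1[of R v v' u] by blast
  next
    case (2 u')
    with \<open>t' = _\<close> show ?thesis
      using betah.intros(2)[of R v u'] step_subst1[of R u u' v] by blast
  qed (use 2 assms(4) in auto)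
next
  case (3 v)
  from assms(3)[unfolded 3] show ?thesis
  proof (cases rule: step_Fst_cases[OF R, consumes 1])
    case (1 w)
    from 1(1) show ?thesis
    proof (cases rule: step_Pr_cases[OF R, consumes 1])
      case (1 a)
      with \<open>t'' = _\<close> show ?thesis using betah.intros(3)[of R a v] by blast
    next
      case (2 b)
      with \<open>t'' = _\<close> show ?thesis using betah.intros(3)[of R t' b] by blast
    qed
  qed (use 3 assms(4) in auto)
next
  case (4 u)
  from assms(3)[unfolded 4] show ?thesis
  proof (cases rule: step_Snd_cases[OF R, consumes 1])
    case (1 w)
    from 1(1) show ?thesis
    proof (cases rule: step_Pr_cases[OF R, consumes 1])
      case (1 a)
      with \<open>t'' = _\<close> show ?thesis using betah.intros(4)[of R a t'] by blast
    next
      case (2 b)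
      with \<open>t'' = _\<close> show ?thesis using betah.intros(4)[of R u b] by blast
    qed
  qed (use 4 assms(4) in auto)
next
  case (5 v)
  from assms(3)[unfolded 5] show ?thesis
  proof (cases rule: step_Ite_cases[OF R, consumes 1])
    case 1
    with step_bool_tm[OF R] show ?thesis by blast
  next
    case (2 u')
    then show ?thesis using betah.intros(5)[of R u' v] by blast
  next
    case (3 v')
    then show ?thesis using betah.intros(5)[of R t' v'] by blast
  next
    \<comment> \<open>As \<open>tru R\<close> and \<open>fls R\<close> differ, the condition
      determines the branch, and the reduct would be \<open>t'\<close>.\<close>
    case (4 b)
    with R 5 assms(4) show ?thesis by (auto simp: rewrite_system_def split: if_splits)
  qed
next
  case (6 u)
  from assms(3)[unfolded 6] show ?thesis
  proof (cases rule: step_Ite_cases[OF R, consumes 1])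
    case 1
    with step_bool_tm[OF R] show ?thesis by blast
  next
    case (2 u')
    then show ?thesis using betah.intros(6)[of R u' t'] by blast
  next
    case (3 v')
    then show ?thesis using betah.intros(6)[of R u v'] by blast
  next
    case (4 b)
    with R 6 assms(4) show ?thesis by (auto simp: rewrite_system_def split: if_splits)
  qed
qed

text \<open>The filled context is never an abstraction or a pair and has no function symbol as head,
  so the context forms no new redex with its content. A step of the context is given for every
  \<open>r\<close>, so that it can be replayed with the contractum \<open>t'\<close> in the
  hole.\<close>

lemma step_plug_elim_ctxt:
  assumes R: "rewrite_system R" and "elim_ctxt E" and t: "betah R t t'"
    and "step R (plug E t) s"
  shows "(\<exists>t''. step R t t'' \<and> s = plug E t'') \<or>
    (\<exists>E'. elim_ctxt E' \<and> s = plug E' t \<and> (\<forall>r. step R (plug E r) (plug E' r)))"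
proof -
  have not_redex: "plug E t \<noteq> Lam v \<and> plug E t \<noteq> Pr v w \<and> head_tm (plug E t) \<noteq> Sym f"
    if "elim_ctxt E" for E v w f
    using that head_tm_betah[OF t] head_tm_plug[OF that] by cases auto
  define reduct where "reduct E s \<longleftrightarrow> (\<exists>t''. step R t t'' \<and> s = plug E t'') \<or>
    (\<exists>E'. elim_ctxt E' \<and> s = plug E' t \<and> (\<forall>r. step R (plug E r) (plug E' r)))" for E s
  have App: "reduct E s \<Longrightarrow> reduct (CAppL E u) (App s u)" for E s u
    unfolding reduct_def by (simp, elim disjE exE conjE)
      (blast, intro disjI2 exI[of _ "CAppL _ u"], auto intro: elim_ctxt.intros step.AppL)
  have Fst: "reduct E s \<Longrightarrow> reduct (CFst E) (Fst s)" for E s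
    unfolding reduct_def by (simp, elim disjE exE conjE)
      (blast, intro disjI2 exI[of _ "CFst _"], auto intro: elim_ctxt.intros step.Fst)
  have Snd: "reduct E s \<Longrightarrow> reduct (CSnd E) (Snd s)" for E s
    unfolding reduct_def by (simp, elim disjE exE conjE)
      (blast, intro disjI2 exI[of _ "CSnd _"], auto intro: elim_ctxt.intros step.Snd)
  from assms(2,4) have "reduct E s"
  proof (induction arbitrary: s)
    case 1
    then show ?case by (auto simp: reduct_def)
  next
    case (2 E u)
    from 2(3)[simplified] show ?case
    proof (cases rule: step_App_cases[OF R, consumes 1])
      case (1 w)
      with App[OF 2(2)[OF 1(1)]] show ?thesis by simp
    next
      case (2 u')
      then have "elim_ctxt (CAppL E u')" "s = plug (CAppL E u') t"
        "\<forall>r. step R (plug (CAppL E u) r) (plug (CAppL E u') r)"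
        using \<open>elim_ctxt E\<close> by (auto intro: elim_ctxt.intros step.AppR)
      then show ?thesis unfolding reduct_def by blast
    qed (use not_redex[OF 2(1)] in auto)
  next
    case (3 E)
    from 3(3)[simplified] show ?case
    proof (cases rule: step_Fst_cases[OF R, consumes 1])
      case (1 w)
      with Fst[OF 3(2)[OF 1(1)]] show ?thesis by simp
    qed (use not_redex[OF 3(1)] in auto)
  next
    case (4 E)
    from 4(3)[simplified] show ?case
    proof (cases rule: step_Snd_cases[OF R, consumes 1])
      case (1 w)
      with Snd[OF 4(2)[OF 1(1)]] show ?thesis by simp
    qed (use not_redex[OF 4(1)] in auto)
  qed
  then show ?thesis unfolding reduct_def .
qed


section \<open>Strong normalization\<close>

lemma SN_I: "(\<And>u. step R t u \<Longrightarrow> u \<in> SN R) \<Longrightarrow> t \<in> SN R"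
  unfolding SN_def red_eq_step mem_Collect_eq by (rule accp.accI) simp

lemma SN_step: "t \<in> SN R \<Longrightarrow> step R t u \<Longrightarrow> u \<in> SN R"
  unfolding SN_def red_eq_step mem_Collect_eq by (erule accp_downward) simp

lemma SN_steps: "(step R)\<^sup>*\<^sup>* t u \<Longrightarrow> t \<in> SN R \<Longrightarrow> u \<in> SN R"
  by (induction rule: rtranclp_induct) (auto intro: SN_step)

lemma SN_induct [consumes 1, case_names SN]:
  assumes "t \<in> SN R" and "\<And>t. t \<in> SN R \<Longrightarrow> (\<And>u. step R t u \<Longrightarrow> P u) \<Longrightarrow> P t"
  shows "P t"
proof -
  from assms(1) have "Wellfounded.accp (step R)\<inverse>\<inverse> t" by (simp add: SN_def red_eq_step)
  then show ?thesis
  proof induction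
    case (1 t)
    have "t \<in> SN R"
      unfolding SN_def red_eq_step mem_Collect_eq using 1(1) .
    then show ?case using 1(2) by (rule assms(2)) simp
  qed
qed

lemma SN_induct2 [consumes 2, case_names SN]:
  assumes "t \<in> SN R" and "u \<in> SN R"
    and "\<And>t u. t \<in> SN R \<Longrightarrow> u \<in> SN R \<Longrightarrow> (\<And>t'. step R t t' \<Longrightarrow> P t' u) \<Longrightarrow>
      (\<And>u'. step R u u' \<Longrightarrow> P t u') \<Longrightarrow> P t u"
  shows "P t u"
  using assms(1,2)
proof (induction t arbitrary: u rule: SN_induct)
  case t: (SN t)
  from t(3) show ?case
  proof (induction u rule: SN_induct)
    case u: (SN u)
    show ?case by (rule assms(3)) (use t(1,2) u in auto)
  qed
qed

text \<open>An infinite reduction of \<open>t\<close> would be mapped to one of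
  \<open>f t\<close>.\<close>

lemma SN_preimage:
  assumes "f t \<in> SN R" and "\<And>a b. step R a b \<Longrightarrow> step R (f a) (f b)"
  shows "t \<in> SN R"
proof -
  have "\<forall>t. s = f t \<longrightarrow> t \<in> SN R" if "s \<in> SN R" for s
    using that by (induction rule: SN_induct) (blast intro: SN_I assms(2))
  then show ?thesis using assms(1) by blast
qed

lemma SN_plug_preimage: "plug K t \<in> SN R \<Longrightarrow> t \<in> SN R"
  by (rule SN_preimage[where f = "plug K"]) (auto intro: step_plug)

text \<open>Recovers termination of the body from the contractum. The argument cannot be recovered
  in this way, since the body may drop its variable.\<close>

lemma SN_subst1_preimage: "subst1 u t \<in> SN R \<Longrightarrow> u \<in> SN R"
  by (rule SN_preimage[where f = "\<lambda>u. subst1 u t"]) (auto intro: step_subst1)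

section \<open>Termination of variable-headed terms and of head expansions\<close>

lemma SN_App_var:
  assumes R: "rewrite_system R" and "t \<in> SN R" and "u \<in> SN R" and "head_tm t = Var x"
  shows "App t u \<in> SN R"
  using assms(2-)
proof (induction rule: SN_induct2)
  case (SN t u)
  show ?case
  proof (rule SN_I)
    fix s assume "step R (App t u) s"
    then show "s \<in> SN R"
    proof (cases rule: step_App_cases[OF R, consumes 1])
      case (1 t')
      then show ?thesis using SN(3)[OF 1(1) head_tm_step_Var[OF 1(1) R SN(5)]] by simp
    next
      case (2 u')
      then show ?thesis using SN(4)[OF 2(1) SN(5)] by simp
    qed (use SN(5) in auto)
  qed
qed

lemma SN_Fst_var:
  assumes R: "rewrite_system R" and "t \<in> SN R" and "head_tm t = Var x"
  shows "Fst t \<in> SN R"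
  using assms(2-)
proof (induction rule: SN_induct)
  case (SN t)
  show ?case
  proof (rule SN_I)
    fix s assume "step R (Fst t) s"
    then show "s \<in> SN R"
    proof (cases rule: step_Fst_cases[OF R, consumes 1])
      case (1 t')
      then show ?thesis using SN(2)[OF 1(1) head_tm_step_Var[OF 1(1) R SN(3)]] by simp
    qed (use SN(3) in auto)
  qed
qed

lemma SN_Snd_var:
  assumes R: "rewrite_system R" and "t \<in> SN R" and "head_tm t = Var x"
  shows "Snd t \<in> SN R"
  using assms(2-)
proof (induction rule: SN_induct)
  case (SN t)
  show ?case
  proof (rule SN_I)
    fix s assume "step R (Snd t) s"
    then show "s \<in> SN R"
    proof (cases rule: step_Snd_cases[OF R, consumes 1])
      case (1 t')
      then show ?thesis using SN(2)[OF 1(1) head_tm_step_Var[OF 1(1) R SN(3)]] by simp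
    qed (use SN(3) in auto)
  qed
qed

text \<open>The induction is on \<open>t\<close> and \<open>u\<close>. Termination of the contractum
  is an invariant, because a step in either component turns the contractum into one of its
  reducts.\<close>

lemma SN_App_Lam:
  assumes R: "rewrite_system R" and "t \<in> SN R" and "subst1 u t \<in> SN R"
  shows "App (Lam u) t \<in> SN R"
  using assms(2) SN_subst1_preimage[OF assms(3)] assms(3)
proof (induction rule: SN_induct2)
  case (SN t u)
  show ?case
  proof (rule SN_I)
    fix s assume "step R (App (Lam u) t) s"
    then show "s \<in> SN R"
    proof (cases rule: step_App_cases[OF R, consumes 1])
      case (1 w)
      from 1(1) obtain u' where u': "step R u u'" "w = Lam u'" by (rule step_Lam_cases[OF R])
      have "subst1 u' t \<in> SN R" using SN_step[OF SN(5) step_subst1[OF u'(1)]] .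
      then show ?thesis using SN(4)[OF u'(1)] u'(2) 1(2) by simp
    next
      case (2 t')
      have "subst1 u t' \<in> SN R" using SN_steps[OF steps_subst1[OF 2(1)] SN(5)] .
      then show ?thesis using SN(3)[OF 2(1)] 2(2) by simp
    qed (use SN(5) in auto)
  qed
qed

lemma SN_LetIn:
  assumes R: "rewrite_system R" and "t \<in> SN R" and "subst1 u t \<in> SN R"
  shows "LetIn t u \<in> SN R"
  using assms(2) SN_subst1_preimage[OF assms(3)] assms(3)
proof (induction rule: SN_induct2)
  case (SN t u)
  show ?case
  proof (rule SN_I)
    fix s assume "step R (LetIn t u) s"
    then show "s \<in> SN R"
    proof (cases rule: step_LetIn_cases[OF R, consumes 1])
      case (1 t')
      have "subst1 u t' \<in> SN R" using SN_steps[OF steps_subst1[OF 1(1)] SN(5)] .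
      then show ?thesis using SN(3)[OF 1(1)] 1(2) by simp
    next
      case (2 u')
      have "subst1 u' t \<in> SN R" using SN_step[OF SN(5) step_subst1[OF 2(1)]] .
      then show ?thesis using SN(4)[OF 2(1)] 2(2) by simp
    qed (use SN(5) in auto)
  qed
qed

lemma SN_proj_Pr:
  assumes R: "rewrite_system R" and "t \<in> SN R" and "u \<in> SN R"
  shows "Fst (Pr t u) \<in> SN R" and "Snd (Pr t u) \<in> SN R"
proof -
  show "Fst (Pr t u) \<in> SN R" using assms(2,3)
  proof (induction rule: SN_induct2)
    case (SN t u)
    show ?case
    proof (rule SN_I)
      fix s assume "step R (Fst (Pr t u)) s"
      then show "s \<in> SN R"
      proof (cases rule: step_Fst_cases[OF R, consumes 1])
        case (1 w)
        from 1(1) show ?thesis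
          by (cases rule: step_Pr_cases[OF R, consumes 1]) (use SN(3,4) 1(2) in blast)+
      qed (use SN(1,2) in auto)
    qed
  qed
  show "Snd (Pr t u) \<in> SN R" using assms(2,3)
  proof (induction rule: SN_induct2)
    case (SN t u)
    show ?case
    proof (rule SN_I)
      fix s assume "step R (Snd (Pr t u)) s"
      then show "s \<in> SN R"
      proof (cases rule: step_Snd_cases[OF R, consumes 1])
        case (1 w)
        from 1(1) show ?thesis
          by (cases rule: step_Pr_cases[OF R, consumes 1]) (use SN(3,4) 1(2) in blast)+
      qed (use SN(1,2) in auto)
    qed
  qed
qed

text \<open>By lexicographic induction on \<open>t\<close> and \<open>plug E t'\<close>.\<close>

lemma SN_plug_betah:
  assumes R: "rewrite_system R" and "t \<in> SN R" and "betah R t t'" and "elim_ctxt E"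
    and "plug E t' \<in> SN R"
  shows "plug E t \<in> SN R"
  using assms(2-)
proof (induction t arbitrary: t' E rule: SN_induct)
  case t: (SN t)
  \<comment> \<open>\<open>s\<close> stands for \<open>plug E t'\<close>; the equation lets
    \<open>E\<close> change when a step of the context shrinks \<open>s\<close>.\<close>
  have "elim_ctxt E \<Longrightarrow> s = plug E t' \<Longrightarrow> plug E t \<in> SN R" if "s \<in> SN R" for s E
    using that
  proof (induction s arbitrary: E rule: SN_induct)
    case s: (SN s)
    show ?case
    proof (rule SN_I)
      fix w assume "step R (plug E t) w"
      then consider (redex) t'' where "step R t t''" "w = plug E t''"
        | (ctxt) E' where "elim_ctxt E'" "w = plug E' t" "\<forall>r. step R (plug E r) (plug E' r)"
        using step_plug_elim_ctxt[OF R s(3) t(3)] by blast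
      then show "w \<in> SN R"
      proof cases
        case redex
        show ?thesis
        proof (cases "t'' = t'")
          case True
          with redex s show ?thesis by simp
        next
          case False
          \<comment> \<open>The outer measure drops from \<open>t\<close> to \<open>t''\<close>, so
            the new contractum need only terminate in \<open>E\<close>; it does, as
            \<open>plug E r\<close> is a reduct of \<open>plug E t'\<close>.\<close>
          with betah_step_commute[OF R t(3) redex(1)] obtain r
            where "betah R t'' r" "(step R)\<^sup>*\<^sup>* t' r" by blast
          moreover from this s(1,4) have "plug E r \<in> SN R"
            by (blast intro: SN_steps steps_plug)
          ultimately show ?thesis using t(2)[OF redex(1)] s(3) redex(2) by blast
        qed
      next
        case ctxt
        with s show ?thesis by blast
      qed
    qed
  qed
  with t(4,5) show ?case by blast
qed

text \<open>Newman's lemma. First steps \<open>a\<close> and \<open>b\<close> have a common reduct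
  \<open>c\<close>; the induction hypothesis at \<open>a\<close> and at \<open>b\<close> identifies
  both \<open>u\<close> and \<open>v\<close> with a normal form of \<open>c\<close>.\<close>

lemma SN_unique_nf:
  assumes lc: "locally_confluent (step R)" and "t \<in> SN R"
    and "(step R)\<^sup>*\<^sup>* t u" "\<nexists>w. step R u w" and "(step R)\<^sup>*\<^sup>* t v" "\<nexists>w. step R v w"
  shows "u = v"
  using assms(2-)
proof (induction t arbitrary: u v rule: SN_induct)
  case (SN t)
  have exists_nf: "\<exists>w. (step R)\<^sup>*\<^sup>* a w \<and> (\<nexists>w'. step R w w')" if "a \<in> SN R" for a
    using that by (induction rule: SN_induct) (meson converse_rtranclp_into_rtranclp rtranclp.rtrancl_refl)
  show ?case
  proof (cases "t = u \<or> t = v")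
    case True
    with SN show ?thesis by (metis converse_rtranclpE)
  next
    case False
    with SN(3,5) obtain a b where a: "step R t a" "(step R)\<^sup>*\<^sup>* a u"
      and b: "step R t b" "(step R)\<^sup>*\<^sup>* b v" by (metis converse_rtranclpE)
    with lc obtain c where c: "(step R)\<^sup>*\<^sup>* a c" "(step R)\<^sup>*\<^sup>* b c"
      unfolding locally_confluent_def by blast
    from SN(1) a(1) c(1) have "c \<in> SN R" by (blast intro: SN_step SN_steps)
    then obtain w where w: "(step R)\<^sup>*\<^sup>* c w" "\<nexists>w'. step R w w'" using exists_nf by blast
    have "u = w" using SN(2)[OF a(1,2) SN(4)] c(1) w by (meson rtranclp_trans)
    moreover have "v = w" using SN(2)[OF b(1,2) SN(6)] c(2) w by (meson rtranclp_trans)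
    ultimately show ?thesis by simp
  qed
qed

lemma SN_nf:
  assumes R: "rewrite_system R" and "t \<in> SN R"
  shows "(step R)\<^sup>*\<^sup>* t (nf R t)" and "\<nexists>v. step R (nf R t) v"
proof -
  have "\<exists>w. (step R)\<^sup>*\<^sup>* t w \<and> (\<nexists>w'. step R w w')"
    using assms(2)
    by (induction rule: SN_induct) (meson converse_rtranclp_into_rtranclp rtranclp.rtrancl_refl)
  moreover have "locally_confluent (step R)"
    using R by (simp add: rewrite_system_def red_eq_step)
  ultimately have "\<exists>!w. (step R)\<^sup>*\<^sup>* t w \<and> (\<nexists>w'. step R w w')"
    using SN_unique_nf[OF _ assms(2)] by blast
  from theI'[OF this] show "(step R)\<^sup>*\<^sup>* t (nf R t)" "\<nexists>v. step R (nf R t) v"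
    unfolding nf_def red_eq_step by blast+
qed

lemma nf_step:
  assumes R: "rewrite_system R" and "t \<in> SN R" and "step R t u"
  shows "nf R u = nf R t"
proof (rule SN_unique_nf[OF _ assms(2)])
  show "locally_confluent (step R)" using R by (simp add: rewrite_system_def red_eq_step)
  have "u \<in> SN R" using assms by (blast intro: SN_step)
  then show "(step R)\<^sup>*\<^sup>* t (nf R u)" "\<nexists>v. step R (nf R u) v"
    using SN_nf[OF R] assms(3) by (blast intro: converse_rtranclp_into_rtranclp)+
qed (use SN_nf[OF R assms(2)] in blast)+


section \<open>Saturated sets\<close>

lemma SAT_SN: "S \<in> SAT R \<Longrightarrow> t \<in> S \<Longrightarrow> t \<in> SN R"
  unfolding SAT_def by blast

lemma SAT_step: "S \<in> SAT R \<Longrightarrow> t \<in> S \<Longrightarrow> step R t u \<Longrightarrow> u \<in> S"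
  unfolding SAT_def red_eq_step by blast

lemma SAT_var: "S \<in> SAT R \<Longrightarrow> elim_ctxt E \<Longrightarrow> plug E (Var x) \<in> SN R \<Longrightarrow> plug E (Var x) \<in> S"
  unfolding SAT_def by blast

lemma SAT_plug_betah:
  "S \<in> SAT R \<Longrightarrow> elim_ctxt E \<Longrightarrow> t \<in> SN R \<Longrightarrow> betah R t t' \<Longrightarrow> plug E t' \<in> S \<Longrightarrow> plug E t \<in> S"
  unfolding SAT_def by blast

lemma SAT_betah: "S \<in> SAT R \<Longrightarrow> t \<in> SN R \<Longrightarrow> betah R t t' \<Longrightarrow> t' \<in> S \<Longrightarrow> t \<in> S"
  using SAT_plug_betah[of S R Hole] by (auto intro: elim_ctxt.intros)

lemma SAT_I:
  assumes "\<And>t. t \<in> S \<Longrightarrow> t \<in> SN R"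
    and "\<And>t t'. t \<in> S \<Longrightarrow> step R t t' \<Longrightarrow> t' \<in> S"
    and "\<And>E x. elim_ctxt E \<Longrightarrow> plug E (Var x) \<in> SN R \<Longrightarrow> plug E (Var x) \<in> S"
    and "\<And>E t t'. elim_ctxt E \<Longrightarrow> t \<in> SN R \<Longrightarrow> betah R t t' \<Longrightarrow> plug E t' \<in> S \<Longrightarrow> plug E t \<in> S"
  shows "S \<in> SAT R"
  using assms unfolding SAT_def red_eq_step by auto

lemma Var_SN:
  assumes "rewrite_system R"
  shows "Var x \<in> SN R"
proof (rule SN_I)
  fix u assume "step R (Var x) u"
  then show "u \<in> SN R"
    using head_tm_rstep[OF assms, of "Var x"] by cases (auto elim: betah.cases)
qed

lemma SAT_Var: "rewrite_system R \<Longrightarrow> S \<in> SAT R \<Longrightarrow> Var x \<in> S"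
  using SAT_var[of S R Hole] Var_SN by (auto intro: elim_ctxt.intros)

text \<open>This is the value of a universal type at an unsatisfiable binder; it also shows that
  \<open>SAT R\<close> is nonempty, so that \<open>\<Inter>(SAT R)\<close> is saturated.\<close>

lemma SN_SAT:
  assumes "rewrite_system R"
  shows "SN R \<in> SAT R"
proof (rule SAT_I)
  show "\<And>E t t'. elim_ctxt E \<Longrightarrow> t \<in> SN R \<Longrightarrow> betah R t t' \<Longrightarrow> plug E t' \<in> SN R \<Longrightarrow> plug E t \<in> SN R"
    using SN_plug_betah[OF assms] by blast
qed (assumption | erule (1) SN_step)+

lemma SAT_Inter:
  assumes "\<S> \<subseteq> SAT R" and "\<S> \<noteq> {}"
  shows "\<Inter>\<S> \<in> SAT R"
proof (rule SAT_I)
  fix t assume "t \<in> \<Inter>\<S>"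
  with assms show "t \<in> SN R" by (meson Inter_iff SAT_SN all_not_in_conv subsetD)
next
  fix t t' assume "t \<in> \<Inter>\<S>" "step R t t'"
  with assms show "t' \<in> \<Inter>\<S>" by (blast intro: SAT_step)
next
  fix E :: "'a ctxt" and x assume "elim_ctxt E" "plug E (Var x) \<in> SN R"
  with assms show "plug E (Var x) \<in> \<Inter>\<S>" by (blast intro: SAT_var)
next
  fix E :: "'a ctxt" and t t'
  assume "elim_ctxt E" "t \<in> SN R" "betah R t t'" "plug E t' \<in> \<Inter>\<S>"
  with assms show "plug E t \<in> \<Inter>\<S>" by (blast intro: SAT_plug_betah)
qed

text \<open>Each closure condition has at most one membership premise, so a single member of the
  family suffices. The condition on variables has none; there nonemptiness provides the
  member.\<close>

lemma SAT_Union: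
  assumes "\<S> \<subseteq> SAT R" and "\<S> \<noteq> {}"
  shows "\<Union>\<S> \<in> SAT R"
proof (rule SAT_I)
  fix t assume "t \<in> \<Union>\<S>"
  with assms show "t \<in> SN R" by (blast intro: SAT_SN)
next
  fix t t' assume "t \<in> \<Union>\<S>" "step R t t'"
  with assms show "t' \<in> \<Union>\<S>" by (blast intro: SAT_step)
next
  fix E :: "'a ctxt" and x assume "elim_ctxt E" "plug E (Var x) \<in> SN R"
  with assms show "plug E (Var x) \<in> \<Union>\<S>" by (blast intro: SAT_var)
next
  fix E :: "'a ctxt" and t t'
  assume "elim_ctxt E" "t \<in> SN R" "betah R t t'" "plug E t' \<in> \<Union>\<S>"
  with assms show "plug E t \<in> \<Union>\<S>" by (blast intro: SAT_plug_betah)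
qed

lemma fun_set_SAT:
  assumes R: "rewrite_system R" and S: "S \<in> SAT R" and S': "S' \<in> SAT R"
  shows "fun_set S S' \<in> SAT R"
proof (rule SAT_I)
  fix t assume "t \<in> fun_set S S'"
  \<comment> \<open>Variables inhabit \<open>S\<close>, so \<open>t\<close> occurs inside a
    terminating application.\<close>
  then have "App t (Var 0) \<in> S'" using SAT_Var[OF R S] unfolding fun_set_def by blast
  then have "plug (CAppL Hole (Var 0)) t \<in> SN R" using SAT_SN[OF S'] by simp
  then show "t \<in> SN R" by (rule SN_plug_preimage)
next
  fix t t' assume "t \<in> fun_set S S'" "step R t t'"
  then show "t' \<in> fun_set S S'" unfolding fun_set_def by (blast intro: SAT_step[OF S'] step.AppL)
next
  fix E :: "'a ctxt" and x assume E: "elim_ctxt E" "plug E (Var x) \<in> SN R"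
  have "plug (CAppL E u) (Var x) \<in> S'" if "u \<in> S" for u
  proof (rule SAT_var[OF S'])
    show "plug (CAppL E u) (Var x) \<in> SN R"
      using SN_App_var[OF R E(2) SAT_SN[OF S that]] head_tm_plug[OF E(1)] by simp
  qed (use E in \<open>auto intro: elim_ctxt.intros\<close>)
  then show "plug E (Var x) \<in> fun_set S S'" by (simp add: fun_set_def)
next
  fix E :: "'a ctxt" and t t'
  assume "elim_ctxt E" "t \<in> SN R" "betah R t t'" "plug E t' \<in> fun_set S S'"
  then have "plug (CAppL E u) t \<in> S'" if "u \<in> S" for u
    using that by (intro SAT_plug_betah[OF S' elim_ctxt.intros(2), of E t t' u]) (auto simp: fun_set_def)
  then show "plug E t \<in> fun_set S S'" by (simp add: fun_set_def)
qed

lemma prod_set_SAT: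
  assumes R: "rewrite_system R" and S: "S \<in> SAT R" and S': "S' \<in> SAT R"
  shows "prod_set S S' \<in> SAT R"
proof (rule SAT_I)
  fix t assume "t \<in> prod_set S S'"
  then have "plug (CFst Hole) t \<in> SN R" using SAT_SN[OF S] unfolding prod_set_def by simp
  then show "t \<in> SN R" by (rule SN_plug_preimage)
next
  fix t t' assume "t \<in> prod_set S S'" "step R t t'"
  then show "t' \<in> prod_set S S'"
    unfolding prod_set_def by (blast intro: SAT_step[OF S] SAT_step[OF S'] step.Fst step.Snd)
next
  fix E :: "'a ctxt" and x assume E: "elim_ctxt E" "plug E (Var x) \<in> SN R"
  then have "plug (CFst E) (Var x) \<in> SN R" "plug (CSnd E) (Var x) \<in> SN R"
    using SN_Fst_var[OF R] SN_Snd_var[OF R] head_tm_plug[OF E(1)] by simp_all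
  then have "plug (CFst E) (Var x) \<in> S" "plug (CSnd E) (Var x) \<in> S'"
    using E by (auto intro!: SAT_var[OF S] SAT_var[OF S'] intro: elim_ctxt.intros simp del: plug.simps)
  then show "plug E (Var x) \<in> prod_set S S'" by (simp add: prod_set_def)
next
  fix E :: "'a ctxt" and t t'
  assume "elim_ctxt E" "t \<in> SN R" "betah R t t'" "plug E t' \<in> prod_set S S'"
  then show "plug E t \<in> prod_set S S'"
    using SAT_plug_betah[OF S elim_ctxt.intros(3), of E t t']
      SAT_plug_betah[OF S' elim_ctxt.intros(4), of E t t'] by (simp add: prod_set_def)
qed

text \<open>Excluding a constant, instead of prescribing one, admits variable-headed terms: their
  reducts keep the variable as head, so their normal forms are never constants. Head expansion
  leaves the normal form unchanged.\<close>

lemma nf_neq_SAT: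
  assumes R: "rewrite_system R"
  shows "{t \<in> SN R. nf R t \<noteq> bool_tm R b} \<in> SAT R"
proof (rule SAT_I)
  fix t t' assume "t \<in> {t \<in> SN R. nf R t \<noteq> bool_tm R b}" "step R t t'"
  then show "t' \<in> {t \<in> SN R. nf R t \<noteq> bool_tm R b}" using nf_step[OF R] by (auto intro: SN_step)
next
  fix E :: "'a ctxt" and x assume E: "elim_ctxt E" "plug E (Var x) \<in> SN R"
  have "head_tm u = Var x" if "(step R)\<^sup>*\<^sup>* (plug E (Var x)) u" for u
    using that by induction (use head_tm_plug[OF E(1)] head_tm_step_Var[OF _ R] in auto)
  from this[OF SN_nf(1)[OF R E(2)]] show "plug E (Var x) \<in> {t \<in> SN R. nf R t \<noteq> bool_tm R b}"
    using E(2) by auto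
next
  fix E :: "'a ctxt" and t t'
  assume *: "elim_ctxt E" "t \<in> SN R" "betah R t t'" "plug E t' \<in> {t \<in> SN R. nf R t \<noteq> bool_tm R b}"
  then have "plug E t \<in> SN R" by (auto intro: SN_plug_betah[OF R])
  moreover have "step R (plug E t) (plug E t')" using *(3) by (intro step_plug step.betah)
  ultimately show "plug E t \<in> {t \<in> SN R. nf R t \<noteq> bool_tm R b}" using *(4) nf_step[OF R] by auto
qed auto

lemma interp_SAT:
  assumes R: "rewrite_system R" and I: "base_type_interp R I"
  shows "interp A R I \<mu> T \<in> SAT R"
proof (induction T arbitrary: \<mu>)
  case (TBool a)
  then show ?case using nf_neq_SAT[OF R] by simp
next
  case (TBase B a)
  then show ?case using I by (simp add: base_type_interp_def)
next
  case (Arr U V)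
  then show ?case by (simp add: fun_set_SAT[OF R])
next
  case (Prod U V)
  then show ?case by (simp add: prod_set_SAT[OF R])
next
  case (TAll m n P T)
  then have "(\<lambda>\<kappa>. interp A R I (ext_valn m n \<kappa> \<mu>) T) ` K \<subseteq> SAT R" for K by blast
  \<comment> \<open>The condition of the case distinction says exactly that the family is
    nonempty.\<close>
  from SAT_Inter[OF this] show ?case using SN_SAT[OF R] by auto
next
  case (TEx m n P T)
  then have "(\<lambda>\<kappa>. interp A R I (ext_valn m n \<kappa> \<mu>) T) ` K \<subseteq> SAT R" for K by blast
  from SAT_Union[OF this] show ?case using SN_SAT[OF R] SAT_Inter[of "SAT R" R] by auto
qed


section \<open>Semantic substitution\<close>

text \<open>Semantic counterpart of a substitution: \<open>shift\<close> becomes forgetting the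
  bound block, \<open>up_ssub\<close> keeping it, and \<open>inst_ssub\<close> choosing its
  values.\<close>

definition sub_valn :: "('g, 'd) size_alg \<Rightarrow> 'd valn \<Rightarrow> 'g ssub \<Rightarrow> 'd valn" where
  "sub_valn A \<mu> s = (\<lambda>i. neval A \<mu> (fst s i), \<lambda>i. beval A \<mu> (snd s i))"

lemma neval_nsub: "neval A \<mu> (nsub s a) = neval A (sub_valn A \<mu> s) a"
  and beval_bsub: "beval A \<mu> (bsub s b) = beval A (sub_valn A \<mu> s) b"
  by (induction a and b) (auto simp: sub_valn_def intro!: arg_cong2[of _ _ _ _ "nfunI A _"]
      arg_cong2[of _ _ _ _ "bfunI A _"])

lemma sub_valn_shift: "sub_valn A (ext_valn m n \<kappa> \<mu>) (shift m n) = \<mu>"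
  by (simp add: sub_valn_def shift_def ext_valn_def)

lemma sub_valn_up: "sub_valn A (ext_valn m n \<kappa> \<mu>) (up_ssub m n s) = ext_valn m n \<kappa> (sub_valn A \<mu> s)"
proof -
  have ext: "fst (ext_valn m n \<kappa> \<nu>) i = (if i < m then fst \<kappa> i else fst \<nu> (i - m))"
    "snd (ext_valn m n \<kappa> \<nu>) i = (if i < n then snd \<kappa> i else snd \<nu> (i - n))" for \<nu> and i
    by (simp_all add: ext_valn_def)
  have shift: "neval A (ext_valn m n \<kappa> \<mu>) (nsub (shift m n) a) = neval A \<mu> a"
    "beval A (ext_valn m n \<kappa> \<mu>) (bsub (shift m n) b) = beval A \<mu> b" for a b
    by (simp_all add: neval_nsub beval_bsub sub_valn_shift)
  show ?thesis
    by (rule prod_eqI; rule HOL.ext) (simp_all add: sub_valn_def up_ssub_def shift ext)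
qed

lemma sub_valn_inst: "sub_valn A \<mu> (inst_ssub m n a) = ext_valn m n (sub_valn A \<mu> a) \<mu>"
  by (auto simp: sub_valn_def inst_ssub_def ext_valn_def)

lemma sat_csub: "sat A \<mu> (csub s C) \<longleftrightarrow> sat A (sub_valn A \<mu> s) C"
  by (induction C arbitrary: \<mu> s) (auto simp: neval_nsub beval_bsub sub_valn_up)

text \<open>The values at unsatisfiable binders are respected too, because satisfiability is judged
  at the current valuation and transfers by \<open>sat_csub\<close>.\<close>

lemma interp_tsub: "interp A R I \<mu> (tsub s T) = interp A R I (sub_valn A \<mu> s) T"
  by (induction T arbitrary: \<mu> s) (auto simp: neval_nsub beval_bsub sub_valn_up sat_csub)

lemma interp_shift: "interp A R I (ext_valn m n \<kappa> \<mu>) (tsub (shift m n) T) = interp A R I \<mu> T"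
  by (simp add: interp_tsub sub_valn_shift)

lemma models_ext:
  assumes "models A R I \<mu> \<sigma> C \<Gamma>" and "sat A (ext_valn m n \<kappa> \<mu>) P"
  shows "models A R I (ext_valn m n \<kappa> \<mu>) \<sigma> (CAnd (csub (shift m n) C) P) (env_shift m n \<Gamma>)"
  using assms by (auto simp: models_def env_shift_def sat_csub sub_valn_shift interp_shift)

lemma models_extend:
  assumes "models A R I \<mu> \<sigma> C \<Gamma>" and "t \<in> interp A R I \<mu> T"
  shows "models A R I \<mu> (case_nat t \<sigma>) C (extend \<Gamma> T)"
  using assms by (auto simp: models_def extend_def split: nat.split)


section \<open>Soundness of subtyping and typing\<close>

text \<open>Valuations are pairs; splitting a quantified \<open>\<kappa>\<close> into components
  would break up the terms \<open>ext_valn m n \<kappa> \<mu>\<close>.\<close>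

declare split_paired_All [simp del] split_paired_Ex [simp del]

text \<open>Each unfolding equation is sound by itself, so the overlaps between them are harmless.
  In \<open>ex_right\<close> and \<open>all_left\<close> the constraint itself supplies the
  witness.\<close>

lemma interp_sub_constr:
  assumes R: "rewrite_system R" and I: "base_type_interp R I"
    and "sub_constr T U D" and "sat A \<mu> D"
  shows "interp A R I \<mu> T \<subseteq> interp A R I \<mu> U"
  using assms(3,4)
proof (induction arbitrary: \<mu>)
  case (arr T' T C U U' D)
  then have "interp A R I \<mu> T' \<subseteq> interp A R I \<mu> T" "interp A R I \<mu> U \<subseteq> interp A R I \<mu> U'" by auto
  then show ?case by (auto simp: fun_set_def)
next
  case (prod T T' C U U' D)
  then have "interp A R I \<mu> T \<subseteq> interp A R I \<mu> T'" "interp A R I \<mu> U \<subseteq> interp A R I \<mu> U'" by auto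
  then show ?case by (auto simp: prod_set_def)
next
  case (ex_right T m n U C P)
  then obtain \<kappa> where \<kappa>: "sat A (ext_valn m n \<kappa> \<mu>) P" "sat A (ext_valn m n \<kappa> \<mu>) C" by auto
  from ex_right.IH[OF \<kappa>(2)] \<kappa>(1) show ?case by (auto simp: interp_shift)
next
  case (ex_left U m n T C P)
  have "interp A R I (ext_valn m n \<kappa> \<mu>) U \<subseteq> interp A R I \<mu> T"
    if "sat A (ext_valn m n \<kappa> \<mu>) P" for \<kappa>
    using ex_left.IH[of "ext_valn m n \<kappa> \<mu>"] ex_left.prems that by (simp add: interp_shift)
  \<comment> \<open>If no extension satisfies \<open>P\<close>, the left side is the least saturated
    set.\<close>
  then show ?case using interp_SAT[OF R I, of A \<mu> T] by auto
next
  case (all_right m n T U C P)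
  have "interp A R I \<mu> T \<subseteq> interp A R I (ext_valn m n \<kappa> \<mu>) U"
    if "sat A (ext_valn m n \<kappa> \<mu>) P" for \<kappa>
    using all_right.IH[of "ext_valn m n \<kappa> \<mu>"] all_right.prems that by (simp add: interp_shift)
  \<comment> \<open>If no extension satisfies \<open>P\<close>, the right side is
    \<open>SN R\<close>.\<close>
  then show ?case using SAT_SN[OF interp_SAT[OF R I, of A \<mu> T]] by auto
next
  case (all_left T U m n C P)
  then obtain \<kappa> where \<kappa>: "sat A (ext_valn m n \<kappa> \<mu>) P" "sat A (ext_valn m n \<kappa> \<mu>) C" by auto
  from all_left.IH[OF \<kappa>(2)] \<kappa>(1) show ?case by (auto simp: interp_shift)
qed auto

lemma interp_subtype:
  assumes "rewrite_system R" and "base_type_interp R I"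
    and "subtype A C T U" and "sat A \<mu> C"
  shows "interp A R I \<mu> T \<subseteq> interp A R I \<mu> U"
  using assms interp_sub_constr[OF assms(1,2)] unfolding subtype_def valid_def by fastforce

text \<open>There are two valuations because existential elimination takes \<open>t\<close> at an
  extended valuation and \<open>U\<close> at the original one.\<close>

lemma interp_LetIn:
  assumes R: "rewrite_system R" and I: "base_type_interp R I"
    and "t \<in> interp A R I \<mu> T" and "subst1 u t \<in> interp A R I \<nu> U"
  shows "LetIn t u \<in> interp A R I \<nu> U"
proof (rule SAT_betah[OF interp_SAT[OF R I] _ betah.intros(2) assms(4)])
  show "LetIn t u \<in> SN R"
    using assms(3,4) by (intro SN_LetIn[OF R]) (auto dest: SAT_SN[OF interp_SAT[OF R I]])
qed

text \<open>Head expansion does not suffice: the condition need not be a constant, and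
  \<open>Ite\<close> is not an elimination context. By induction on all three components, every
  one-step reduct lies in \<open>S\<close>; contraction yields a branch.\<close>

lemma SAT_Ite:
  assumes R: "rewrite_system R" and S: "S \<in> SAT R" and ntp: "neutral_term_property R S"
    and "t \<in> SN R" and "u \<in> S" and "v \<in> S"
  shows "Ite t u v \<in> S"
  using assms(4-)
proof (induction t arbitrary: u v rule: SN_induct)
  case t: (SN t)
  from SAT_SN[OF S t(3)] SAT_SN[OF S t(4)] t(3,4) show ?case
  proof (induction rule: SN_induct2)
    case (SN u v)
    have "s \<in> S" if "step R (Ite t u v) s" for s
      using that
      by (cases rule: step_Ite_cases[OF R, consumes 1]) (use SN t(2) SAT_step[OF S] in auto)
    then show ?case
      using ntp neutral.intros(2) unfolding neutral_term_property_def red_eq_step by blast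
  qed
qed

theorem theorem2:
  fixes A :: "('g, 'd) size_alg" and R :: "'s crs"
    and \<tau> :: "'s \<Rightarrow> ('b, 'g) ty" and I :: "'b \<Rightarrow> 'd \<Rightarrow> 's tm set"
    and C :: "'g constr" and \<Gamma> :: "('b, 'g) env" and t :: "'s tm" and T :: "('b, 'g) ty"
    and \<mu> :: "'d valn" and \<sigma> :: "nat \<Rightarrow> 's tm"
  assumes "size_algebra A"
    and "rewrite_system R"
    and "type_assignment A R \<tau>"
    and "base_type_interp R I"
    and "valid_interp A R \<tau> I"
    and "\<forall>f\<in>funs R. computable A R \<tau> I f"
    and "environment A \<Gamma>"
    and "typing A \<tau> C \<Gamma> t T"
    and "models A R I \<mu> \<sigma> C \<Gamma>"
  shows "subst \<sigma> t \<in> interp A R I \<mu> T"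
proof -
  note R = assms(2) and I = assms(4)
  note SAT = interp_SAT[OF R I]
  have sat: "sat A \<mu> P" if "valid A (CImp C P)" "models A R I \<mu> \<sigma> C \<Gamma>" for \<mu> \<sigma> C \<Gamma> P
    using that by (auto simp: valid_def models_def)
  show ?thesis using assms(8,9)
  proof (induction arbitrary: \<mu> \<sigma>)
    case (var \<Gamma> x T C)
    then show ?case by (simp add: models_def)
  next
    case (symb C \<Gamma> s)
    then show ?case
      using assms(5,6) by (cases "s \<in> funs R") (auto simp: valid_interp_def computable_def)
  next
    case (abs T C \<Gamma> u U)
    have "App (Lam (subst (up \<sigma>) u)) s \<in> interp A R I \<mu> U" if s: "s \<in> interp A R I \<mu> T" for s
    proof (rule SAT_betah[OF SAT _ betah.intros(1)])
      show *: "subst1 (subst (up \<sigma>) u) s \<in> interp A R I \<mu> U"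
        using abs.IH[OF models_extend[OF abs.prems s]] by (simp add: subst1_up)
      show "App (Lam (subst (up \<sigma>) u)) s \<in> SN R"
        using SAT_SN[OF SAT *] SAT_SN[OF SAT s] by (intro SN_App_Lam[OF R])
    qed
    then show ?case by (simp add: fun_set_def)
  next
    case (app C \<Gamma> t U V u)
    then show ?case by (fastforce simp: fun_set_def)
  next
    case (pair C \<Gamma> u U v V)
    then have uv: "subst \<sigma> u \<in> interp A R I \<mu> U" "subst \<sigma> v \<in> interp A R I \<mu> V" by auto
    \<comment> \<open>Products are defined by projections, so a pair is tested by head expansion of
      its two projections.\<close>
    note SN = SN_proj_Pr[OF R SAT_SN[OF SAT uv(1)] SAT_SN[OF SAT uv(2)]]
    show ?case
      using SAT_betah[OF SAT SN(1) betah.intros(3) uv(1)]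
        SAT_betah[OF SAT SN(2) betah.intros(4) uv(2)] by (simp add: prod_set_def)
  next
    case (fst C \<Gamma> t U V)
    then show ?case by (fastforce simp: prod_set_def)
  next
    case (snd C \<Gamma> t U V)
    then show ?case by (fastforce simp: prod_set_def)
  next
    case (ite C \<Gamma> t u T v)
    have "subst \<sigma> t \<in> SN R" using SAT_SN[OF SAT ite.IH(1)[OF ite.prems]] .
    moreover have "neutral_term_property R (interp A R I \<mu> T)"
      using assms(5) ite.hyps by (simp add: valid_interp_def)
    ultimately show ?case using SAT_Ite[OF R SAT] ite.IH(2,3)[OF ite.prems] by simp
  next
    case (letin C \<Gamma> t T u U)
    note t = letin.IH(1)[OF letin.prems]
    have "subst1 (subst (up \<sigma>) u) (subst \<sigma> t) \<in> interp A R I \<mu> U"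
      using letin.IH(2)[OF models_extend[OF letin.prems t]] by (simp add: subst1_up)
    then show ?case using interp_LetIn[OF R I t] by simp
  next
    case (all_intro P C m n \<Gamma> t T)
    \<comment> \<open>The satisfiability premise, used at this \<open>\<mu>\<close>, selects the
      intersection.\<close>
    from sat[OF all_intro.hyps(3) all_intro.prems] all_intro.IH[OF models_ext[OF all_intro.prems]]
    show ?case by simp
  next
    case (all_elim C \<Gamma> t m n P T a)
    \<comment> \<open>The values of the expressions \<open>a\<close> at \<open>\<mu>\<close> form
      the extension to be selected; it also witnesses that \<open>P\<close> is satisfiable at
      \<open>\<mu>\<close>.\<close>
    have "sat A (ext_valn m n (sub_valn A \<mu> a) \<mu>) P"
      using sat[OF all_elim.hyps(2) all_elim.prems] by (simp add: sat_csub sub_valn_inst)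
    with all_elim.IH[OF all_elim.prems] show ?case
      by (auto simp: interp_tsub sub_valn_inst split: if_splits)
  next
    case (ex_intro m n P T C \<Gamma> t a)
    have "sat A (ext_valn m n (sub_valn A \<mu> a) \<mu>) P"
      using sat[OF ex_intro.hyps(3) ex_intro.prems] by (simp add: sat_csub sub_valn_inst)
    with ex_intro.IH[OF ex_intro.prems] show ?case
      by (auto simp: interp_tsub sub_valn_inst)
  next
    case (ex_elim C \<Gamma> t m n P T u U)
    from ex_elim.IH(1)[OF ex_elim.prems] sat[OF ex_elim.hyps(3) ex_elim.prems]
    obtain \<kappa> where \<kappa>: "sat A (ext_valn m n \<kappa> \<mu>) P"
      and t: "subst \<sigma> t \<in> interp A R I (ext_valn m n \<kappa> \<mu>) T" by auto
    \<comment> \<open>The body is interpreted at the valuation extended by \<open>\<kappa>\<close>;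
      since \<open>U\<close> is shifted under the binder, this is its interpretation at
      \<open>\<mu>\<close>.\<close>
    have "subst1 (subst (up \<sigma>) u) (subst \<sigma> t) \<in> interp A R I \<mu> U"
      using ex_elim.IH(2)[OF models_extend[OF models_ext[OF ex_elim.prems \<kappa>] t]]
      by (simp add: subst1_up interp_shift)
    then show ?case using interp_LetIn[OF R I t] by simp
  next
    case (sub T' C \<Gamma> t T)
    have "sat A \<mu> C" using sub.prems by (simp add: models_def)
    with interp_subtype[OF R I sub.hyps(3)] sub.IH[OF sub.prems] show ?case by blast
  qed
qed

end
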